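(* Let $A\in{\rm O}(n)$ and let $\Delta\subset\mathbb{R}^n_q$ be a smooth convex body with ${\rm Fix}(A)\cap{\rm Int}(\Delta)\ne\emptyset$. If $\Delta$ contains a ball $B^{n}(\bar{q},r)$ with $A\bar{q}=\bar{q}$, then $$\frac{r\, \mathfrak{t}(\Psi_A)}{2}\le \inf\{L(\sigma) : \sigma\text{ is an } A\text{-billiard trajectory in }\Delta\}.$$
   Context: A convex body in $\mathbb{R}^n$ is a compact convex subset with nonempty interior; it is smooth if its boundary is smooth. $B^n(\bar q,r)$ is the open ball of center $\bar q$ and radius $r>0$. ${\rm Fix}(A)$ is the fixed point set of $A$. $J=\begin{pmatrix}0&-I_n\\ I_n&0\end{pmatrix}$. For $A\in{\rm GL}(n)$, $\Psi_A(q,v)=(Aq,(A^t)^{-1}v)$ on $\mathbb{R}^{2n}=\mathbb{R}^n_q\times\mathbb{R}^n_p$. For $\Psi\in{\rm Sp}(2n,\mathbb{R})$, $\mathfrak{t}(\Psi)$ is the smallest $s\in(0,2\pi]$ with $\det(\Psi-e^{sJ})=0$ (the set of such $s$ is nonempty and finite). $A$-billiard trajectory: let $\Omega\subset\mathbb{R}^n$ be a convex body with $C^2$ boundary and $A\in{\rm O}(n)$. A nonconstant, continuous, piecewise $C^\infty$ path $\sigma:[0,T]\to\Omega$ with $\sigma(T)=A\sigma(0)$ is an $A$-billiard trajectory in $\Omega$ if there is a finite set $\mathscr{B}_\sigma\subset(0,T)$ such that $\ddot\sigma\equiv0$ on $(0,T)\setminus\mathscr{B}_\sigma$ and: (ABi)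 $\sharp\mathscr{B}_\sigma\ge1$ and $\sigma(t)\in\partial\Omega$ for all $t\in\mathscr{B}_\sigma$. (ABii) For each $t\in\mathscr{B}_\sigma$, $\dot\sigma^\pm(t):=\lim_{\tau\to t\pm}\dot\sigma(\tau)$ satisfy $\dot\sigma^+(t)+\dot\sigma^-(t)\in T_{\sigma(t)}\partial\Omega$ and $\dot\sigma^+(t)-\dot\sigma^-(t)\in(T_{\sigma(t)}\partial\Omega)^\perp\setminus\{0\}$. Put $\dot\sigma^+(0)=\lim_{t\to0+}\dot\sigma(t)$ and $\dot\sigma^-(T)=\lim_{t\to T-}\dot\sigma(t)$. If $\sigma(0)\in\partial\Omega$, let $\dot\sigma^-(0)$ be the unique vector with $\dot\sigma^+(0)+\dot\sigma^-(0)\in T_{\sigma(0)}\partial\Omega$ and $\dot\sigma^+(0)-\dot\sigma^-(0)\in(T_{\sigma(0)}\partial\Omega)^\perp$. If $\sigma(T)\in\partial\Omega$, let $\dot\sigma^+(T)$ be the unique vector with $\dot\sigma^+(T)+\dot\sigma^-(T)\in T_{\sigma(T)}\partial\Omega$ and $\dot\sigma^+(T)-\dot\sigma^-(T)\in(T_{\sigma(T)}\partial\Omega)^\perp$. Consider the equalities (a) $A\dot\sigma^+(0)=\dot\sigma^-(T)$; (b) $A\dot\sigma^-(0)=\dot\sigma^-(T)$; (c) $A\dot\sigma^+(0)=\dot\sigma^+(T)$; (d) $A\dot\sigma^-(0)=\dot\sigma^+(T)$. (ABiii) If $\sigma(0),\sigma(T)\in{\rm int}\,\Omega$, then (a) holds.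 (ABiv) If $\sigma(0)\in\partial\Omega$ and $\sigma(T)\in{\rm int}\,\Omega$, then (a) or (b) holds. (ABv) If $\sigma(0)\in{\rm int}\,\Omega$ and $\sigma(T)\in\partial\Omega$, then (a) or (c) holds. (ABvi) If $\sigma(0),\sigma(T)\in\partial\Omega$, then (a), (b), (c) or (d) holds. Length: if $\mathscr{B}_\sigma=\{t_1<\dots<t_{m-1}\}$, $q_0=\sigma(0)$, $q_j=\sigma(t_j)$ for $1\le j\le m-1$, $q_m=\sigma(T)$, then $L(\sigma)=\sum_{j=0}^{m-1}\|q_{j+1}-q_j\|$. The infimum of the empty set is $+\infty$. *)

theory Defs
  imports "HOL-Analysis.Analysis"
begin

section \<open>Smooth convex bodies\<close>

text \<open>In finite dimensions, for open \<open>U\<close>, continuity of all iterated directional derivatives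
  up to order \<open>k\<close> is the same as being of class \<open>C\<^sup>k\<close>.\<close>

fun Ck_on :: "nat \<Rightarrow> ('a::real_normed_vector \<Rightarrow> 'b::real_normed_vector) \<Rightarrow> 'a set \<Rightarrow> bool" where
  "Ck_on 0 f U \<longleftrightarrow> continuous_on U f"
| "Ck_on (Suc k) f U \<longleftrightarrow>
     (\<forall>x\<in>U. f differentiable (at x)) \<and>
     (\<forall>v. Ck_on k (\<lambda>x. frechet_derivative f (at x) v) U)"

definition smooth_on :: "'a::real_normed_vector set \<Rightarrow> ('a \<Rightarrow> 'b::real_normed_vector) \<Rightarrow> bool" where
  "smooth_on U f \<longleftrightarrow> (\<forall>k. Ck_on k f U)"

definition smooth_hypersurface :: "'a::euclidean_space set \<Rightarrow> bool" where
  "smooth_hypersurface S \<longleftrightarrow>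
     (\<forall>x\<in>S. \<exists>U (f :: 'a \<Rightarrow> real). open U \<and> x \<in> U \<and> smooth_on U f \<and>
        (\<forall>y\<in>U. frechet_derivative f (at y) \<noteq> (\<lambda>_. 0)) \<and>
        S \<inter> U = {y \<in> U. f y = 0})"

definition convex_body :: "'a::euclidean_space set \<Rightarrow> bool" where
  "convex_body \<Omega> \<longleftrightarrow> compact \<Omega> \<and> convex \<Omega> \<and> interior \<Omega> \<noteq> {}"

definition smooth_convex_body :: "'a::euclidean_space set \<Rightarrow> bool" where
  "smooth_convex_body \<Omega> \<longleftrightarrow> convex_body \<Omega> \<and> smooth_hypersurface (frontier \<Omega>)"

text \<open>Velocities at \<open>x\<close> of \<open>C\<^sup>1\<close> curves lying in \<open>S\<close>.\<close>

definition tangent_space :: "'a::euclidean_space set \<Rightarrow> 'a \<Rightarrow> 'a set" where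
  "tangent_space S x =
     {v. \<exists>\<epsilon>>0. \<exists>\<gamma> \<gamma>' :: real \<Rightarrow> 'a.
           (\<forall>t\<in>{-\<epsilon><..<\<epsilon>}. \<gamma> t \<in> S \<and> (\<gamma> has_vector_derivative \<gamma>' t) (at t)) \<and>
           continuous_on {-\<epsilon><..<\<epsilon>} \<gamma>' \<and> \<gamma> 0 = x \<and> \<gamma>' 0 = v}"


section \<open>Billiard trajectories\<close>

text \<open>Smoothness on a compact interval is understood as being the restriction of a smooth
  function on the whole real line.\<close>

definition piecewise_smooth :: "real \<Rightarrow> (real \<Rightarrow> 'a::euclidean_space) \<Rightarrow> bool" where
  "piecewise_smooth T \<sigma> \<longleftrightarrow>
     (\<exists>P. finite P \<and>
        (\<forall>a b. 0 \<le> a \<and> a < b \<and> b \<le> T \<and> {a<..<b} \<inter> P = {} \<longrightarrow>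
           (\<exists>g. smooth_on UNIV g \<and> (\<forall>t\<in>{a..b}. \<sigma> t = g t))))"

definition velocity :: "(real \<Rightarrow> 'a::euclidean_space) \<Rightarrow> real \<Rightarrow> 'a" where
  "velocity \<sigma> t = vector_derivative \<sigma> (at t)"

definition vel_plus :: "(real \<Rightarrow> 'a::euclidean_space) \<Rightarrow> real \<Rightarrow> 'a" where
  "vel_plus \<sigma> t = Lim (at_right t) (velocity \<sigma>)"

definition vel_minus :: "(real \<Rightarrow> 'a::euclidean_space) \<Rightarrow> real \<Rightarrow> 'a" where
  "vel_minus \<sigma> t = Lim (at_left t) (velocity \<sigma>)"

text \<open>The conventional velocities \<open>\<sigma>'\<^sup>-(0)\<close> and \<open>\<sigma>'\<^sup>+(T)\<close> ``before'' the start and ``after'' the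
  end of the path; only meaningful if \<open>\<sigma> 0\<close>, respectively \<open>\<sigma> T\<close>, is a boundary point.\<close>

definition vel_before_start :: "'a::euclidean_space set \<Rightarrow> (real \<Rightarrow> 'a) \<Rightarrow> 'a" where
  "vel_before_start \<Omega> \<sigma> =
     (THE w. vel_plus \<sigma> 0 + w \<in> tangent_space (frontier \<Omega>) (\<sigma> 0) \<and>
             vel_plus \<sigma> 0 - w \<in> orthogonal_comp (tangent_space (frontier \<Omega>) (\<sigma> 0)))"

definition vel_after_end :: "'a::euclidean_space set \<Rightarrow> real \<Rightarrow> (real \<Rightarrow> 'a) \<Rightarrow> 'a" where
  "vel_after_end \<Omega> T \<sigma> =
     (THE w. w + vel_minus \<sigma> T \<in> tangent_space (frontier \<Omega>) (\<sigma> T) \<and>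
             w - vel_minus \<sigma> T \<in> orthogonal_comp (tangent_space (frontier \<Omega>) (\<sigma> T)))"

text \<open>The set \<open>B\<close> of bouncing times is carried along explicitly; it is determined by \<open>\<sigma>\<close>, being
  the set of points of \<open>{0<..<T}\<close> at which \<open>\<sigma>\<close> is not differentiable. Only the values of \<open>\<sigma>\<close> on
  \<open>{0..T}\<close> matter.\<close>

definition billiard_trajectory ::
  "real^'n^'n \<Rightarrow> (real^'n) set \<Rightarrow> real \<Rightarrow> real set \<Rightarrow> (real \<Rightarrow> real^'n) \<Rightarrow> bool" where
  "billiard_trajectory A \<Omega> T B \<sigma> \<longleftrightarrow>
     0 < T \<and> \<sigma> ` {0..T} \<subseteq> \<Omega> \<and>
     \<not> \<sigma> constant_on {0..T} \<and> continuous_on {0..T} \<sigma> \<and> piecewise_smooth T \<sigma> \<and>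
     \<sigma> T = A *v \<sigma> 0 \<and>
     finite B \<and> B \<subseteq> {0<..<T} \<and>
     (\<forall>t\<in>{0<..<T} - B. \<sigma> differentiable (at t) \<and>
                       (velocity \<sigma> has_vector_derivative 0) (at t)) \<and>
     card B \<ge> 1 \<and> (\<forall>t\<in>B. \<sigma> t \<in> frontier \<Omega>) \<and>
     (\<forall>t\<in>B. vel_plus \<sigma> t + vel_minus \<sigma> t \<in> tangent_space (frontier \<Omega>) (\<sigma> t) \<and>
            vel_plus \<sigma> t - vel_minus \<sigma> t
              \<in> orthogonal_comp (tangent_space (frontier \<Omega>) (\<sigma> t)) - {0}) \<and>
     (let a = (A *v vel_plus \<sigma> 0 = vel_minus \<sigma> T);
          b = (A *v vel_before_start \<Omega> \<sigma> = vel_minus \<sigma> T);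
          c = (A *v vel_plus \<sigma> 0 = vel_after_end \<Omega> T \<sigma>);
          d = (A *v vel_before_start \<Omega> \<sigma> = vel_after_end \<Omega> T \<sigma>)
      in (\<sigma> 0 \<in> interior \<Omega> \<and> \<sigma> T \<in> interior \<Omega> \<longrightarrow> a) \<and>
         (\<sigma> 0 \<in> frontier \<Omega> \<and> \<sigma> T \<in> interior \<Omega> \<longrightarrow> a \<or> b) \<and>
         (\<sigma> 0 \<in> interior \<Omega> \<and> \<sigma> T \<in> frontier \<Omega> \<longrightarrow> a \<or> c) \<and>
         (\<sigma> 0 \<in> frontier \<Omega> \<and> \<sigma> T \<in> frontier \<Omega> \<longrightarrow> a \<or> b \<or> c \<or> d))"

definition billiard_length :: "real \<Rightarrow> real set \<Rightarrow> (real \<Rightarrow> real^'n) \<Rightarrow> real" where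
  "billiard_length T B \<sigma> =
     (let ts = 0 # sorted_list_of_set B @ [T]
      in \<Sum>j<length ts - 1. norm (\<sigma> (ts ! Suc j) - \<sigma> (ts ! j)))"


section \<open>The quantity t of a symplectic matrix\<close>

text \<open>Block matrices on \<open>\<real>\<^sup>2\<^sup>n = \<real>\<^sup>n \<times> \<real>\<^sup>n\<close>: \<open>Inl\<close> indexes the position coordinates, \<open>Inr\<close> the
  momentum coordinates.\<close>

definition block_matrix ::
  "real^'n^'n \<Rightarrow> real^'n^'n \<Rightarrow> real^'n^'n \<Rightarrow> real^'n^'n \<Rightarrow> real^('n::finite + 'n)^('n + 'n)" where
  "block_matrix P Q R S =
     (\<chi> i j. case i of
        Inl k \<Rightarrow> (case j of Inl l \<Rightarrow> P $ k $ l | Inr l \<Rightarrow> Q $ k $ l)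
      | Inr k \<Rightarrow> (case j of Inl l \<Rightarrow> R $ k $ l | Inr l \<Rightarrow> S $ k $ l))"

definition J_matrix :: "real^('n::finite + 'n)^('n + 'n)" where
  "J_matrix = block_matrix 0 (- mat 1) (mat 1) 0"

definition Psi :: "real^'n^'n \<Rightarrow> real^('n::finite + 'n)^('n + 'n)" where
  "Psi A = block_matrix A 0 0 (matrix_inv (transpose A))"

text \<open>The product on \<open>real^'n^'n\<close> inherited from the type classes is componentwise, so \<open>exp\<close> and
  \<open>^\<close> are not available for matrices.\<close>

definition matrix_exp :: "real^'m^'m \<Rightarrow> real^'m^'m" where
  "matrix_exp M = (\<Sum>k. (((**) M ^^ k) (mat 1)) /\<^sub>R fact k)"

definition t_min :: "real^('n::finite + 'n)^('n + 'n) \<Rightarrow> real" where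
  "t_min \<Psi> = (LEAST s. 0 < s \<and> s \<le> 2 * pi \<and> det (\<Psi> - matrix_exp (s *\<^sub>R J_matrix)) = 0)"

end

theory Submission
  imports Defs
begin

text \<open>
  A trajectory has constant speed \<open>\<omega>\<close>, so summation by parts turns \<open>\<omega> L(\<sigma>)\<close> into a sum, over the
  bounces, of position relative to \<open>qbar\<close> times velocity jump. A jump is an inward normal vector, and
  the distance from \<open>qbar\<close> to a supporting hyperplane is at least \<open>r\<close>, so \<open>\<omega> L(\<sigma>) \<ge> r V\<close> with \<open>V\<close>
  the total variation of the velocity. Each of the end conditions (a)--(d) says that, after adding a
  bounce at the start or at the end where necessary, the velocity polygon on the sphere of radius
  \<open>\<omega>\<close> runs from some \<open>u\<close> to \<open>A u\<close>; the boundary terms then cancel because \<open>A\<close> is an isometry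
  fixing \<open>qbar\<close>.

  It remains to see \<open>V \<ge> \<omega> t / 2\<close>. For \<open>A = 1\<close> the polygon is closed and not contained in an open
  half-space, so \<open>V \<ge> 4 \<omega> \<ge> \<pi> \<omega>\<close>. Otherwise \<open>t \<le> \<pi>\<close> is the least rotation angle of \<open>A\<close>: off the fixed
  space \<open>A\<close> displaces vectors by at least the factor \<open>2 sin (t / 2) \<ge> t / 2\<close>, while in the direction of
  the fixed space the polygon has to go to the opposite side and back.
\<close>

section \<open>Tangent spaces of smooth convex bodies\<close>

definition outer_normal :: "'a::euclidean_space set \<Rightarrow> 'a \<Rightarrow> 'a \<Rightarrow> bool" where
  "outer_normal \<Omega> x \<nu> \<longleftrightarrow> norm \<nu> = 1 \<and> (\<forall>y\<in>\<Omega>. \<nu> \<bullet> (y - x) \<le> 0)"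

lemma outer_normal_exists:
  assumes "convex_body \<Omega>" "x \<in> frontier \<Omega>"
  obtains \<nu> where "outer_normal \<Omega> x \<nu>"
proof -
  have c: "convex \<Omega>" "closed \<Omega>" "interior \<Omega> \<noteq> {}"
    using assms(1) compact_imp_closed by (auto simp: convex_body_def)
  have ri: "rel_interior \<Omega> = interior \<Omega>"
    using c(3) by (simp add: rel_interior_interior affine_hull_nonempty_interior)
  have "x \<in> closure \<Omega>" "x \<notin> rel_interior \<Omega>"
    using assms(2) ri by (auto simp: frontier_def)
  then obtain a where a: "\<And>y. y \<in> closure \<Omega> \<Longrightarrow> a \<bullet> x \<le> a \<bullet> y"
    and a': "\<And>y. y \<in> rel_interior \<Omega> \<Longrightarrow> a \<bullet> x < a \<bullet> y"
    using supporting_hyperplane_relative_frontier[OF c(1)] by metis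
  have "a \<noteq> 0" using a' ri c(3) by fastforce
  have "outer_normal \<Omega> x (- (a /\<^sub>R norm a))"
    unfolding outer_normal_def
  proof (intro conjI ballI)
    show "norm (- (a /\<^sub>R norm a)) = 1" using \<open>a \<noteq> 0\<close> by simp
    fix y assume "y \<in> \<Omega>"
    then have "a \<bullet> x \<le> a \<bullet> y" using a closure_subset by blast
    then show "- (a /\<^sub>R norm a) \<bullet> (y - x) \<le> 0"
      by (simp add: inner_diff_right mult_left_mono)
  qed
  then show ?thesis using that by blast
qed

text \<open>A \<open>C^1\<close> implicit function theorem for the zero set. After \<open>F\<close>
  straightens it, two points with the same image differ by a multiple of \<open>n\<close>, and the
  mean value theorem along \<open>n\<close> makes \<open>F\<close> injective. Invariance of domain
  makes its image open, so a short piece of the line through \<open>w\<close> can be pulled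
  back.\<close>

lemma curve_in_zero_set:
  fixes f :: "'a::euclidean_space \<Rightarrow> real"
  assumes "open U" "x \<in> U" "f x = 0"
    and df: "\<And>y. y \<in> U \<Longrightarrow> (f has_derivative f' y) (at y)"
    and cf: "\<And>v. continuous_on U (\<lambda>y. f' y v)"
    and n: "f' x n = 1" and w: "f' x w = 0"
  obtains \<epsilon> \<gamma> \<gamma>' where "\<epsilon> > 0"
    "\<And>t::real. t \<in> {-\<epsilon><..<\<epsilon>} \<Longrightarrow> \<gamma> t \<in> U \<and> f (\<gamma> t) = 0 \<and> (\<gamma> has_vector_derivative \<gamma>' t) (at t)"
    "continuous_on {-\<epsilon><..<\<epsilon>} \<gamma>'" "\<gamma> 0 = x" "\<gamma>' 0 = w"
proof -
  have lin: "linear (f' y)" if "y \<in> U" for y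
    using df[OF that] has_derivative_linear by blast
  have blx: "bounded_linear (f' x)"
    using df[OF assms(2)] has_derivative_bounded_linear by blast
  interpret fx: bounded_linear "f' x" by (rule blx)
  have "open {y \<in> U. 0 < f' y n}"
  proof -
    have "open (U \<inter> (\<lambda>y. f' y n) -` {0<..})"
      using cf[of n] assms(1) by (intro continuous_open_preimage) auto
    then show ?thesis by (simp add: vimage_def Int_def)
  qed
  then obtain e where e: "e > 0" "ball x e \<subseteq> {y \<in> U. 0 < f' y n}"
    using assms(2) n by (metis (mono_tags, lifting) mem_Collect_eq open_contains_ball zero_less_one)
  define S where "S = ball x e"
  have S: "open S" "convex S" "x \<in> S" using e(1) by (auto simp: S_def)
  have SU: "y \<in> U" "0 < f' y n" if "y \<in> S" for y using that e by (auto simp: S_def)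
  \<comment> \<open>\<open>F\<close> straightens the zero set: \<open>f' x (F y) = f y\<close>, and \<open>F' x\<close> is the identity. The curve is the
     preimage of the line spanned by \<open>w\<close>.\<close>
  define F where "F = (\<lambda>y. (y - x) - f' x (y - x) *\<^sub>R n + f y *\<^sub>R n)"
  define F' where "F' = (\<lambda>y h. h - f' x h *\<^sub>R n + f' y h *\<^sub>R n)"
  \<comment> \<open>\<open>F' y\<close> is the identity plus a rank-one map into the span of
    \<open>n\<close>, which it scales by \<open>f' y n\<close>. Since this factor is positive on
    \<open>S\<close>, \<open>G' y\<close> is the inverse.\<close>
  define G' where "G' = (\<lambda>y h. h - ((f' y h - f' x h) / f' y n) *\<^sub>R n)"
  have dF: "(F has_derivative F' y) (at y)" if "y \<in> S" for y
    unfolding F_def F'_def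
    by (auto intro!: derivative_eq_intros df[OF SU(1)[OF that]] fx.has_derivative simp: that)
  have cF: "continuous_on S F"
    using dF has_derivative_continuous continuous_at_imp_continuous_on by blast
  have fF: "f' x (F y) = f y" for y
    by (simp add: F_def fx.add fx.diff fx.scaleR n)
  have inj: "inj_on F S"
  proof (rule inj_onI)
    fix y z assume yz: "y \<in> S" "z \<in> S" "F y = F z"
    define c where "c = f' x (y - z)"
    have ff: "f y = f z" using fF yz(3) by metis
    have "y - z = c *\<^sub>R n"
    proof -
      have "F y - F z = y - z - c *\<^sub>R n"
        by (simp add: F_def ff c_def fx.diff algebra_simps)
      then show ?thesis using yz by simp
    qed
    have seg: "z + t *\<^sub>R (y - z) \<in> S" if "t \<in> {0..1}" for t
      using convexD_alt[OF S(2) yz(2) yz(1), of t] that by (simp add: algebra_simps)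
    have dphi: "((\<lambda>t. f (z + t *\<^sub>R (y - z))) has_derivative (\<lambda>h. h * f' (z + t *\<^sub>R (y - z)) (y - z))) (at t within {0..1})"
      if "t \<in> {0..1}" for t
    proof -
      have "((\<lambda>t. z + t *\<^sub>R (y - z)) has_derivative (\<lambda>h. h *\<^sub>R (y - z))) (at t within {0..1})"
        by (auto intro!: derivative_eq_intros)
      from has_derivative_compose[OF this df[OF SU(1)[OF seg[OF that]]]]
      show ?thesis using lin[OF SU(1)[OF seg[OF that]]] by (simp add: linear_scale)
    qed
    obtain t where t: "t \<in> {0<..<1}"
      "f (z + 1 *\<^sub>R (y - z)) - f (z + 0 *\<^sub>R (y - z)) = (1 - 0) * f' (z + t *\<^sub>R (y - z)) (y - z)"
      using mvt_simple[of 0 1 "\<lambda>t. f (z + t *\<^sub>R (y - z))"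
        "\<lambda>t h. h * f' (z + t *\<^sub>R (y - z)) (y - z)"] dphi by auto
    have t01: "t \<in> {0..1}" using t by auto
    have "0 = f' (z + t *\<^sub>R (y - z)) (y - z)" using t(2) ff by simp
    also have "\<dots> = f' (z + t *\<^sub>R (y - z)) (c *\<^sub>R n)"
      using \<open>y - z = c *\<^sub>R n\<close> by simp
    also have "\<dots> = c * f' (z + t *\<^sub>R (y - z)) n"
      using lin[OF SU(1)[OF seg[OF t01]]] by (simp add: linear_scale)
    finally have "c = 0" using SU(2)[OF seg[OF t01]] by simp
    then show "y = z" using \<open>y - z = c *\<^sub>R n\<close> by simp
  qed
  have opF: "open (F ` S)" by (rule invariance_of_domain[OF cF S(1) inj])
  have Fx: "F x = 0" by (simp add: F_def assms(3))
  define G where "G = inv_into S F"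
  have GF: "G (F y) = y" if "y \<in> S" for y using that inj by (simp add: G_def)
  have dG: "(G has_derivative G' y) (at (F y))" if "y \<in> S" for y
  proof (rule has_derivative_inverse_on[where S = S and f = F and f' = F'])
    note y = that
    interpret fy: linear "f' y" by (rule lin[OF SU(1)[OF y]])
    show "F' y \<circ> G' y = id"
    proof
      fix h
      define k where "k = (f' y h - f' x h) / f' y n"
      have k: "k * f' y n = f' y h - f' x h" using SU(2)[OF y] by (simp add: k_def)
      have "F' y (G' y h) = h - k *\<^sub>R n - (f' x h - k) *\<^sub>R n + (f' y h - k * f' y n) *\<^sub>R n"
        by (simp add: F'_def G'_def k_def fx.diff fx.scaleR fy.diff fy.scale n)
      also have "\<dots> = h" unfolding k by (simp add: algebra_simps)
      finally show "(F' y \<circ> G' y) h = id h" by simp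
    qed
  qed (use that S dF GF in auto)
  have "open ((\<lambda>t::real. t *\<^sub>R w) -` (F ` S))"
    by (intro continuous_open_vimage opF) (auto intro!: continuous_intros)
  moreover have "0 \<in> (\<lambda>t::real. t *\<^sub>R w) -` (F ` S)" using Fx S(3) by (force simp: image_iff)
  ultimately obtain \<epsilon> where \<epsilon>: "\<epsilon> > 0" "ball 0 \<epsilon> \<subseteq> (\<lambda>t::real. t *\<^sub>R w) -` (F ` S)"
    by (meson open_contains_ball)
  define \<gamma> where "\<gamma> = (\<lambda>t::real. G (t *\<^sub>R w))"
  define \<gamma>' where "\<gamma>' = (\<lambda>t. w - (f' (\<gamma> t) w / f' (\<gamma> t) n) *\<^sub>R n)"
  have gS: "\<gamma> t \<in> S \<and> F (\<gamma> t) = t *\<^sub>R w" if "t \<in> {-\<epsilon><..<\<epsilon>}" for t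
  proof -
    have "t \<in> ball 0 \<epsilon>" using that by auto
    then obtain y where "y \<in> S" "F y = t *\<^sub>R w" using \<epsilon>(2) by force
    then show ?thesis using GF[of y] by (simp add: \<gamma>_def)
  qed
  have dg: "(\<gamma> has_vector_derivative \<gamma>' t) (at t)" if "t \<in> {-\<epsilon><..<\<epsilon>}" for t
  proof -
    have 1: "((\<lambda>t::real. t *\<^sub>R w) has_derivative (\<lambda>h. h *\<^sub>R w)) (at t)"
      by (auto intro!: derivative_eq_intros)
    have 2: "(G has_derivative G' (\<gamma> t)) (at (t *\<^sub>R w))" using dG[of "\<gamma> t"] gS[OF that] by simp
    interpret fy: linear "f' (\<gamma> t)" using lin SU(1) gS[OF that] by blast
    have "(\<gamma> has_derivative (\<lambda>h. G' (\<gamma> t) (h *\<^sub>R w))) (at t)"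
      using has_derivative_compose[OF 1 2] by (simp add: \<gamma>_def)
    moreover have "G' (\<gamma> t) (h *\<^sub>R w) = h *\<^sub>R \<gamma>' t" for h
      by (simp add: G'_def \<gamma>'_def fy.scale fx.scaleR assms algebra_simps)
    ultimately show ?thesis by (simp add: has_vector_derivative_def)
  qed
  have cg: "continuous_on {-\<epsilon><..<\<epsilon>} \<gamma>"
    using dg has_vector_derivative_continuous continuous_at_imp_continuous_on by blast
  have cfg: "continuous_on {-\<epsilon><..<\<epsilon>} (\<lambda>t. f' (\<gamma> t) v)" for v
    using continuous_on_compose2[OF cf[of v] cg] gS SU(1) by blast
  have cg': "continuous_on {-\<epsilon><..<\<epsilon>} \<gamma>'"
    unfolding \<gamma>'_def using gS SU(2) by (intro continuous_intros cfg) (metis less_irrefl)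
  have g0: "\<gamma> 0 = x" using GF[OF S(3)] Fx by (simp add: \<gamma>_def)
  show ?thesis
  proof (rule that)
    show "\<epsilon> > 0" "continuous_on {-\<epsilon><..<\<epsilon>} \<gamma>'" "\<gamma> 0 = x" by fact+
  next
    fix t assume t: "t \<in> {-\<epsilon><..<\<epsilon>}"
    have "f (\<gamma> t) = f' x (t *\<^sub>R w)" using fF[of "\<gamma> t"] gS[OF t] by simp
    then have "f (\<gamma> t) = 0" by (simp add: fx.scaleR w)
    then show "\<gamma> t \<in> U \<and> f (\<gamma> t) = 0 \<and> (\<gamma> has_vector_derivative \<gamma>' t) (at t)"
      using gS[OF t] SU(1) dg[OF t] by blast
  next
    show "\<gamma>' 0 = w" by (simp add: \<gamma>'_def g0 w)
  qed
qed

text \<open>For a defining function \<open>f\<close> near \<open>x\<close>, the kernel of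
  \<open>f' x\<close> lies in the tangent space by \<open>curve_in_zero_set\<close>. The tangent
  space lies in the complement of \<nu>, because \<nu> \<bullet> \<gamma> has a local maximum at
  time 0. Both outer sets are hyperplanes, so all three agree.\<close>

lemma tangent_space_eq_normal_complement:
  assumes "smooth_convex_body \<Omega>" "x \<in> frontier \<Omega>" "outer_normal \<Omega> x \<nu>"
  shows "tangent_space (frontier \<Omega>) x = {v. \<nu> \<bullet> v = 0}"
proof
  have cb: "convex_body \<Omega>" "closed \<Omega>"
    using assms(1) compact_imp_closed by (auto simp: smooth_convex_body_def convex_body_def)
  show sub: "tangent_space (frontier \<Omega>) x \<subseteq> {v. \<nu> \<bullet> v = 0}"
  proof
    fix v assume "v \<in> tangent_space (frontier \<Omega>) x"
    then obtain \<epsilon> \<gamma> \<gamma>' where g: "\<epsilon> > 0"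
      "\<And>t::real. t \<in> {-\<epsilon><..<\<epsilon>} \<Longrightarrow> \<gamma> t \<in> frontier \<Omega> \<and> (\<gamma> has_vector_derivative \<gamma>' t) (at t)"
      "\<gamma> 0 = x" "\<gamma>' 0 = v"
      unfolding tangent_space_def by blast
    have "(\<gamma> has_derivative (\<lambda>h. h *\<^sub>R v)) (at 0)"
      using g(1) g(2)[of 0] g(4) by (simp add: has_vector_derivative_def)
    then have d: "((\<lambda>t. \<nu> \<bullet> \<gamma> t) has_derivative (\<lambda>h. \<nu> \<bullet> (h *\<^sub>R v))) (at 0)"
      by (rule has_derivative_inner_right)
    have "(\<lambda>h. \<nu> \<bullet> (h *\<^sub>R v)) = (\<lambda>h::real. 0)"
    proof (rule has_derivative_local_max[OF d])
      have "\<forall>\<^sub>F y in nhds 0. y \<in> {-\<epsilon><..<\<epsilon>}"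
        by (intro eventually_nhds_in_open) (use g(1) in auto)
      then show "\<forall>\<^sub>F y in at 0. \<nu> \<bullet> \<gamma> y \<le> \<nu> \<bullet> \<gamma> 0"
        unfolding eventually_at_filter
      proof eventually_elim
        case (elim y)
        have "\<gamma> y \<in> \<Omega>" using g(2)[OF elim] frontier_subset_closed[OF cb(2)] by auto
        then have "\<nu> \<bullet> (\<gamma> y - x) \<le> 0" using assms(3) by (simp add: outer_normal_def)
        then show ?case by (simp add: g(3) inner_diff_right)
      qed
    qed
    then have "\<nu> \<bullet> (1 *\<^sub>R v) = 0" by metis
    then show "v \<in> {v. \<nu> \<bullet> v = 0}" by simp
  qed
  have "smooth_hypersurface (frontier \<Omega>)" using assms(1) by (simp add: smooth_convex_body_def)
  then obtain U and f :: "'a \<Rightarrow> real" where U: "open U" "x \<in> U" "smooth_on U f"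
    "\<forall>y\<in>U. frechet_derivative f (at y) \<noteq> (\<lambda>_. 0)" "frontier \<Omega> \<inter> U = {y \<in> U. f y = 0}"
    using assms(2) unfolding smooth_hypersurface_def by blast
  define f' where "f' = (\<lambda>y. frechet_derivative f (at y))"
  have C1: "Ck_on (Suc 0) f U" using U(3) by (simp add: smooth_on_def)
  have df: "(f has_derivative f' y) (at y)" if "y \<in> U" for y
    using C1 that frechet_derivative_works by (auto simp: f'_def)
  have cf: "continuous_on U (\<lambda>y. f' y v)" for v using C1 by (simp add: f'_def)
  have lin: "linear (f' x)" using df[OF U(2)] has_derivative_linear by blast
  have fx: "f x = 0" using U(2,5) assms(2) by blast
  obtain h where h: "f' x h \<noteq> 0" using U(2,4) f'_def by fastforce
  define n where "n = h /\<^sub>R f' x h"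
  have n: "f' x n = 1" using h lin by (simp add: n_def linear_scale)
  have ker: "w \<in> tangent_space (frontier \<Omega>) x" if w: "f' x w = 0" for w
  proof -
    obtain \<epsilon> \<gamma> \<gamma>' where g: "\<epsilon> > 0"
      "\<And>t::real. t \<in> {-\<epsilon><..<\<epsilon>} \<Longrightarrow> \<gamma> t \<in> U \<and> f (\<gamma> t) = 0 \<and> (\<gamma> has_vector_derivative \<gamma>' t) (at t)"
      "continuous_on {-\<epsilon><..<\<epsilon>} \<gamma>'" "\<gamma> 0 = x" "\<gamma>' 0 = w"
      by (rule curve_in_zero_set[OF U(1,2) fx df cf n w]) blast+
    show ?thesis unfolding tangent_space_def using g U(5) by blast
  qed
  show "{v. \<nu> \<bullet> v = 0} \<subseteq> tangent_space (frontier \<Omega>) x"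
  proof
    fix v assume "v \<in> {v. \<nu> \<bullet> v = 0}"
    then have v: "\<nu> \<bullet> v = 0" by simp
    \<comment> \<open>The vector is the projection of \<open>u\<close> to the kernel of
      \<open>f' x\<close> along \<open>n\<close>; hence \<nu> \<bullet> u is the constant \<nu>
      \<bullet> n times \<open>f' x u\<close>.\<close>
    have k: "\<nu> \<bullet> (u - f' x u *\<^sub>R n) = 0" for u
    proof -
      have "f' x (u - f' x u *\<^sub>R n) = 0" using lin n by (simp add: linear_diff linear_scale)
      then show ?thesis using ker sub by blast
    qed
    have "\<nu> \<bullet> n \<noteq> 0"
    proof
      assume "\<nu> \<bullet> n = 0"
      then have "\<nu> \<bullet> \<nu> = 0" using k[of \<nu>] by (simp add: inner_diff_right)
      then show False using assms(3) by (simp add: outer_normal_def)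
    qed
    then have "f' x v = 0" using k[of v] v by (simp add: inner_diff_right)
    then show "v \<in> tangent_space (frontier \<Omega>) x" by (rule ker)
  qed
qed

lemma orthogonal_comp_hyperplane:
  fixes \<nu> :: "'a::euclidean_space"
  assumes "norm \<nu> = 1"
  shows "orthogonal_comp {v. \<nu> \<bullet> v = 0} = {w. w = (\<nu> \<bullet> w) *\<^sub>R \<nu>}"
proof (intro set_eqI iffI)
  have nn: "\<nu> \<bullet> \<nu> = 1" using assms by (simp add: dot_square_norm)
  fix w
  {
    assume w: "w \<in> orthogonal_comp {v. \<nu> \<bullet> v = 0}"
    have z: "\<nu> \<bullet> (w - (\<nu> \<bullet> w) *\<^sub>R \<nu>) = 0" by (simp add: inner_diff_right nn)
    then have "(w - (\<nu> \<bullet> w) *\<^sub>R \<nu>) \<bullet> w = 0"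
      using w by (auto simp: orthogonal_comp_def orthogonal_def)
    then have "(w - (\<nu> \<bullet> w) *\<^sub>R \<nu>) \<bullet> (w - (\<nu> \<bullet> w) *\<^sub>R \<nu>) = 0"
      using z by (simp add: inner_diff_right inner_commute)
    then show "w \<in> {w. w = (\<nu> \<bullet> w) *\<^sub>R \<nu>}" by simp
  next
    assume "w \<in> {w. w = (\<nu> \<bullet> w) *\<^sub>R \<nu>}"
    then have "w = (\<nu> \<bullet> w) *\<^sub>R \<nu>" by simp
    then have "y \<bullet> w = 0" if "\<nu> \<bullet> y = 0" for y
      using that by (metis inner_commute inner_scaleR_right mult_zero_right)
    then show "w \<in> orthogonal_comp {v. \<nu> \<bullet> v = 0}" by (auto simp: orthogonal_comp_def orthogonal_def)
  }
qed

section \<open>Polygons on spheres\<close>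

text \<open>\<open>Q j\<close> is a vertex of the path, with velocity \<open>p j\<close> before it
  and \<open>p (Suc j)\<close> after it, so the edge from \<open>Q j\<close> to
  \<open>Q (Suc j)\<close> is paired with \<open>p (Suc j)\<close>. The sum on the right includes
  the jumps at both end points.\<close>

lemma energy_sum_by_parts:
  fixes p Q :: "nat \<Rightarrow> 'a::real_inner"
  shows "(\<Sum>j<m. (Q (Suc j) - Q j) \<bullet> p (Suc j)) =
    (\<Sum>j\<le>m. Q j \<bullet> (p j - p (Suc j))) + Q m \<bullet> p (Suc m) - Q 0 \<bullet> p 0"
  by (induction m) (simp_all add: inner_diff_left inner_diff_right)

text \<open>Summation by parts, with boundary terms cancelled by \<open>closing\<close>. For
  constant speed the right-hand side is speed times length.\<close>

lemma variation_le_energy: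
  fixes p Q :: "nat \<Rightarrow> 'a::real_inner"
  assumes step: "\<And>j. j < m \<Longrightarrow> Q (Suc j) - Q j = \<tau> j *\<^sub>R p (Suc j)"
    and bounce: "\<And>j. j \<le> m \<Longrightarrow> r * norm (p (Suc j) - p j) \<le> Q j \<bullet> (p j - p (Suc j))"
    and closing: "Q m \<bullet> p (Suc m) = Q 0 \<bullet> p 0"
  shows "r * (\<Sum>j\<le>m. norm (p (Suc j) - p j)) \<le> (\<Sum>j<m. \<tau> j * (norm (p (Suc j)))\<^sup>2)"
proof -
  have "r * (\<Sum>j\<le>m. norm (p (Suc j) - p j)) \<le> (\<Sum>j\<le>m. Q j \<bullet> (p j - p (Suc j)))"
    unfolding sum_distrib_left using bounce by (intro sum_mono) simp
  also have "\<dots> = (\<Sum>j<m. (Q (Suc j) - Q j) \<bullet> p (Suc j))"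
    using energy_sum_by_parts[of Q p m] closing by simp
  also have "\<dots> = (\<Sum>j<m. \<tau> j * (norm (p (Suc j)))\<^sup>2)"
    using step by (intro sum.cong) (simp_all add: power2_norm_eq_inner)
  finally show ?thesis .
qed

lemma chord_le_variation:
  fixes p :: "nat \<Rightarrow> 'a::real_normed_vector"
  assumes "a \<le> b"
  shows "norm (p b - p a) \<le> (\<Sum>j<b. norm (p (Suc j) - p j)) - (\<Sum>j<a. norm (p (Suc j) - p j))"
  using assms
proof (induction rule: dec_induct)
  case (step b)
  have "norm (p (Suc b) - p a) \<le> norm (p (Suc b) - p b) + norm (p b - p a)"
    using norm_triangle_ineq[of "p (Suc b) - p b" "p b - p a"] by simp
  then show ?case using step.IH by simp
qed simp

text \<open>Two arcs of length \<open>V / 2\<close> join \<open>p 0\<close> to \<open>w\<close>.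
  Each vertex lies on one of them, and this arc is at least as long as the broken line from
  \<open>p 0\<close> through the vertex to \<open>w\<close>.\<close>

lemma closed_polygon_midpoint:
  fixes p :: "nat \<Rightarrow> 'a::real_normed_vector"
  assumes closed: "p N = p 0"
  defines "V \<equiv> \<Sum>j<N. norm (p (Suc j) - p j)"
  obtains w where "\<And>i. i \<le> N \<Longrightarrow> norm (p i - p 0) + norm (p i - w) \<le> V / 2"
proof -
  define S where "S = (\<lambda>k. \<Sum>j<k. norm (p (Suc j) - p j))"
  have ch: "norm (p b - p a) \<le> S b - S a" if "a \<le> b" for a b
    using chord_le_variation[OF that, of p] by (simp add: S_def)
  have SN: "S N = V" and S0: "S 0 = 0" by (simp_all add: S_def V_def)
  have V0: "V \<ge> 0" by (auto simp: V_def intro: sum_nonneg)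
  show ?thesis
  proof (cases "V = 0")
    case True
    \<comment> \<open>All vertices coincide, so \<open>p 0\<close> serves as \<open>w\<close>; no
      partial sum exceeds \<open>V / 2\<close>, and the index \<open>k\<close> used in the other
      case would not exist.\<close>
    have "norm (p i - p 0) + norm (p i - p 0) \<le> V / 2" if "i \<le> N" for i
    proof -
      have "norm (p i - p 0) \<le> S i" "norm (p i - p 0) \<le> - S i"
        using ch[of 0 i] ch[OF that] SN S0 True by (simp_all add: closed norm_minus_commute)
      then show ?thesis using True by linarith
    qed
    then show ?thesis using that by blast
  next
    case False
    then have "V / 2 < S N" using V0 SN by simp
    \<comment> \<open>\<open>w\<close> is the point halfway around the polygon, measured by arc length from \<open>p 0\<close>.\<close>
    define k where "k = (LEAST k. V / 2 < S k)"
    have k: "V / 2 < S k" unfolding k_def by (rule LeastI[of _ N]) fact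
    have "k \<le> N" unfolding k_def by (rule Least_le) fact
    have "k \<noteq> 0" using k S0 V0 by (intro notI) simp
    then obtain j where j: "k = Suc j" using not0_implies_Suc by blast
    have Sj: "S j \<le> V / 2" using not_less_Least[of j "\<lambda>k. V / 2 < S k"] j k_def by simp
    define d where "d = norm (p (Suc j) - p j)"
    have SS: "S (Suc j) = S j + d" by (simp add: S_def d_def)
    have d: "d > 0" using SS k j Sj by simp
    \<comment> \<open>The fraction of edge \<open>j\<close> still to be traversed after
      \<open>p j\<close> in order to reach arc length \<open>V / 2\<close>.\<close>
    define l where "l = (V / 2 - S j) / d"
    have l: "0 \<le> l" "l \<le> 1" "l * d = V / 2 - S j" "(1 - l) * d = S (Suc j) - V / 2"
      using d Sj k j SS by (auto simp: l_def field_simps)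
    define w where "w = p j + l *\<^sub>R (p (Suc j) - p j)"
    have w1: "norm (p j - w) = V / 2 - S j"
      using l by (simp add: w_def d_def)
    have "p (Suc j) - w = (1 - l) *\<^sub>R (p (Suc j) - p j)" by (simp add: w_def algebra_simps)
    then have w2: "norm (p (Suc j) - w) = S (Suc j) - V / 2"
      using l by (simp add: d_def)
    have "norm (p i - p 0) + norm (p i - w) \<le> V / 2" if i: "i \<le> N" for i
    proof (cases "i \<le> j")
      case True
      have "norm (p i - w) \<le> norm (p i - p j) + norm (p j - w)"
        using norm_triangle_ineq[of "p i - p j" "p j - w"] by simp
      then show ?thesis using ch[OF True] ch[of 0 i] S0 w1 by (simp add: norm_minus_commute)
    next
      case False
      have "norm (p i - w) \<le> norm (p i - p (Suc j)) + norm (p (Suc j) - w)"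
        using norm_triangle_ineq[of "p i - p (Suc j)" "p (Suc j) - w"] by simp
      then show ?thesis using ch[of "Suc j" i] ch[OF i] False SN w2 closed
        by (simp add: norm_minus_commute)
    qed
    then show ?thesis using that by blast
  qed
qed

text \<open>Chordal counterpart of the fact that a short closed curve on a sphere lies in an open
  hemisphere, which \<open>balanced\<close> excludes. Going to the antipode and back shows that 4 is
  optimal.\<close>

lemma closed_spherical_polygon_variation:
  fixes p :: "nat \<Rightarrow> 'a::real_inner"
  assumes closed: "p N = p 0"
    and sphere: "\<And>j. j \<le> N \<Longrightarrow> norm (p j) = \<omega>"
    and balanced: "\<And>c. \<exists>j\<le>N. p j \<bullet> c \<le> 0"
  shows "4 * \<omega> \<le> (\<Sum>j<N. norm (p (Suc j) - p j))"
proof (rule ccontr)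
  define V where "V = (\<Sum>j<N. norm (p (Suc j) - p j))"
  assume "\<not> ?thesis"
  then have V: "V < 4 * \<omega>" by (simp add: V_def)
  obtain w where w: "\<And>i. i \<le> N \<Longrightarrow> norm (p i - p 0) + norm (p i - w) \<le> V / 2"
    using closed_polygon_midpoint[OF closed] unfolding V_def by blast
  \<comment> \<open>All vertices lie in the ball of radius \<open>V / 4 < \<omega>\<close> about \<open>c\<close>, which misses the half-space
     opposite to \<open>c\<close> on the sphere.\<close>
  define c where "c = (1/2) *\<^sub>R (p 0 + w)"
  have "p i \<bullet> c > 0" if i: "i \<le> N" for i
  proof -
    have "p i - c = (1/2) *\<^sub>R ((p i - p 0) + (p i - w))"
      by (simp add: c_def algebra_simps flip: scaleR_add_left)
    then have "norm (p i - c) = norm ((p i - p 0) + (p i - w)) / 2" by simp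
    also have "\<dots> \<le> (V / 2) / 2"
      using w[OF i] norm_triangle_ineq[of "p i - p 0" "p i - w"] by linarith
    finally have "norm (p i - c) < \<omega>" using V by simp
    then have "(norm (p i - c))\<^sup>2 < \<omega>\<^sup>2" by (intro power_strict_mono) auto
    moreover have "(norm (p i - c))\<^sup>2 = \<omega>\<^sup>2 - 2 * (p i \<bullet> c) + (norm c)\<^sup>2"
      using sphere[OF i] by (simp add: power2_norm_eq_inner inner_diff inner_commute flip: \<open>norm (p i) = \<omega>\<close>)
    ultimately show ?thesis using zero_le_power2[of "norm c"] by linarith
  qed
  then show False using balanced[of c] by fastforce
qed

text \<open>Reflecting the second chord in the hyperplane orthogonal to \<open>x\<close> and adding it to the first one
  gives a vector whose component along \<open>x\<close> is at least \<open>2 norm x\<close>, by \<open>z \<bullet> x \<le> 0\<close>.\<close>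

lemma two_chords_lower_bound:
  fixes x y y' z :: "'a::real_inner"
  assumes "x \<bullet> y = 0" "x \<bullet> y' = 0" "z \<bullet> x \<le> 0"
    and \<kappa>: "0 \<le> \<kappa>" "\<kappa> \<le> 2" "\<kappa> * norm y \<le> norm (y' - y)"
  shows "\<kappa> * norm (x + y) \<le> norm (z - (x + y)) + norm (x + y' - z)"
proof -
  \<comment> \<open>The coefficient of the projection of \<open>z\<close> to the line of
    \<open>x\<close>. For \<open>x = 0\<close> division by zero gives \<open>a = 0\<close>, so
    \<open>z'\<close> is \<open>z\<close> and the argument still applies.\<close>
  define a where "a = (z \<bullet> x) / (x \<bullet> x)"
  define z' where "z' = z - a *\<^sub>R x"
  have a: "a \<le> 0" using assms(3) by (simp add: a_def divide_nonpos_nonneg)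
  have z': "x \<bullet> z' = 0" by (cases "x = 0") (simp_all add: z'_def a_def inner_diff_right inner_commute)
  have z: "z = a *\<^sub>R x + z'" by (simp add: z'_def)
  have flip: "norm (u + v) = norm (v - u)" if "u \<bullet> v = 0" for u v :: 'a
    using that by (simp add: norm_eq_sqrt_inner inner_add inner_diff inner_commute)
  have "x + y' - z = (1 - a) *\<^sub>R x + (y' - z')" by (simp add: z algebra_simps)
  also have "norm \<dots> = norm (y' - z' - (1 - a) *\<^sub>R x)"
    by (rule flip) (simp add: assms z' inner_diff_right)
  finally have n2: "norm (x + y' - z) = norm ((a - 1) *\<^sub>R x + (y' - z'))"
    by (simp add: algebra_simps)
  have n1: "z - (x + y) = (a - 1) *\<^sub>R x + (z' - y)" by (simp add: z algebra_simps)
  have pyth: "(norm (u + v))\<^sup>2 = (norm u)\<^sup>2 + (norm v)\<^sup>2" if "u \<bullet> v = 0" for u v :: 'a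
    using that by (simp add: power2_norm_eq_inner inner_add inner_commute)
  have xy: "((2 * (a - 1)) *\<^sub>R x) \<bullet> (y' - y) = 0" by (simp add: assms inner_diff_right)
  have "(\<kappa> * norm (x + y))\<^sup>2 = (\<kappa> * norm x)\<^sup>2 + (\<kappa> * norm y)\<^sup>2"
    by (simp add: power_mult_distrib pyth assms(1) distrib_left)
  also have "\<dots> \<le> (2 * (1 - a) * norm x)\<^sup>2 + (norm (y' - y))\<^sup>2"
  proof (intro add_mono power_mono mult_right_mono)
    show "\<kappa> \<le> 2 * (1 - a)" using a \<kappa> by simp
  qed (use \<kappa> in auto)
  also have "\<dots> = (norm ((2 * (a - 1)) *\<^sub>R x + (y' - y)))\<^sup>2"
    unfolding pyth[OF xy] by (simp add: power_mult_distrib power2_commute)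
  finally have "\<kappa> * norm (x + y) \<le> norm ((2 * (a - 1)) *\<^sub>R x + (y' - y))"
    by (rule power2_le_imp_le) simp
  also have "(2 * (a - 1)) *\<^sub>R x + (y' - y) = ((a - 1) *\<^sub>R x + (z' - y)) + ((a - 1) *\<^sub>R x + (y' - z'))"
  proof -
    have "(2 * (a - 1)) *\<^sub>R x = (a - 1) *\<^sub>R x + (a - 1) *\<^sub>R x" by (simp flip: scaleR_add_left)
    then show ?thesis by (simp only: algebra_simps)
  qed
  also have "norm \<dots> \<le> norm (z - (x + y)) + norm (x + y' - z)"
    unfolding n1 n2 by (rule norm_triangle_ineq)
  finally show ?thesis .
qed

section \<open>The least angle of an orthogonal matrix\<close>

definition join :: "real^'n \<Rightarrow> real^'n \<Rightarrow> real^('n::finite + 'n)" where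
  "join u w = (\<chi> i. case i of Inl k \<Rightarrow> u $ k | Inr k \<Rightarrow> w $ k)"

lemma join_surj: obtains u w where "x = join u w"
proof
  show "x = join (\<chi> k. x $ Inl k) (\<chi> k. x $ Inr k)"
    by (simp add: join_def vec_eq_iff split: sum.split)
qed

lemma join_eq_0_iff: "join u w = 0 \<longleftrightarrow> u = 0 \<and> w = 0"
  by (auto simp: join_def vec_eq_iff split: sum.split)

lemma block_matrix_join:
  fixes P Q R S :: "real^'n^'n"
  shows "block_matrix P Q R S *v join u w = join (P *v u + Q *v w) (R *v u + S *v w)"
proof -
  have "sum f UNIV = sum (f \<circ> Inl) UNIV + sum (f \<circ> Inr) UNIV" for f :: "'n + 'n \<Rightarrow> real"
    by (subst UNIV_Plus_UNIV[symmetric], subst sum.Plus) simp_all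
  then show ?thesis
    by (simp add: vec_eq_iff block_matrix_def join_def matrix_vector_mult_def split: sum.split)
qed

lemma matrix_vector_mult_minus_left: "(- M) *v x = - (M *v x)" for M :: "'a::ring_1^'n^'m"
  by (simp add: matrix_vector_mult_def vec_eq_iff sum_negf)

lemma J_matrix_join: "J_matrix *v join u w = join (- w) u"
  by (simp add: J_matrix_def block_matrix_join matrix_vector_mult_minus_left)

lemma J_matrix_sq: "J_matrix ** J_matrix = - (mat 1 :: real^('n::finite + 'n)^('n + 'n))"
proof -
  have "(J_matrix ** J_matrix) *v x = (- mat 1) *v x" for x :: "real^('n + 'n)"
  proof -
    obtain u w where "x = join u w" by (rule join_surj)
    moreover have "- join u w = join (- u) (- w)" by (simp add: join_def vec_eq_iff split: sum.split)
    ultimately show ?thesis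
      by (simp add: J_matrix_join matrix_vector_mult_minus_left flip: matrix_vector_mul_assoc)
  qed
  then show ?thesis by (simp add: matrix_eq)
qed

lemma matrix_mult_scaleR_right: "M ** (k *\<^sub>R N) = k *\<^sub>R (M ** N)"
  for M :: "real^'n^'m" and N :: "real^'l^'n"
  by (simp add: matrix_scalar_ac scalar_matrix_assoc)

text \<open>Because \<open>J_matrix\<close> squares to minus the identity, the exponential series
  splits term by term into the cosine and sine series, whose coefficients already contain the
  factorials.\<close>

lemma J_matrix_power:
  fixes s :: real
  shows "((**) (s *\<^sub>R J_matrix) ^^ k) (mat 1) /\<^sub>R fact k =
    (cos_coeff k * s ^ k) *\<^sub>R mat 1 + (sin_coeff k * s ^ k) *\<^sub>R (J_matrix :: real^('n::finite + 'n)^('n + 'n))"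
proof (induction k)
  case (Suc k)
  let ?J = "J_matrix :: real^('n + 'n)^('n + 'n)"
  have "((**) (s *\<^sub>R ?J) ^^ Suc k) (mat 1) /\<^sub>R fact (Suc k)
      = (s / Suc k) *\<^sub>R (?J ** (((**) (s *\<^sub>R ?J) ^^ k) (mat 1) /\<^sub>R fact k))"
    by (simp add: scalar_matrix_assoc[symmetric] matrix_mult_scaleR_right divide_simps)
  also have "\<dots> = (s / Suc k) *\<^sub>R ((cos_coeff k * s ^ k) *\<^sub>R ?J - (sin_coeff k * s ^ k) *\<^sub>R mat 1)"
    unfolding Suc.IH by (simp add: matrix_add_ldistrib matrix_mult_scaleR_right J_matrix_sq)
  also have "\<dots> = (cos_coeff (Suc k) * s ^ Suc k) *\<^sub>R mat 1 + (sin_coeff (Suc k) * s ^ Suc k) *\<^sub>R ?J"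
    by (simp add: cos_coeff_Suc sin_coeff_Suc algebra_simps)
  finally show ?case .
qed (simp add: cos_coeff_def sin_coeff_def)

lemma matrix_exp_J: "matrix_exp (s *\<^sub>R J_matrix) = cos s *\<^sub>R mat 1 + sin s *\<^sub>R J_matrix"
proof -
  have "(\<lambda>k. (cos_coeff k * s ^ k) *\<^sub>R mat 1 + (sin_coeff k * s ^ k) *\<^sub>R J_matrix)
     sums (cos s *\<^sub>R mat 1 + sin s *\<^sub>R (J_matrix :: real^('n::finite + 'n)^('n + 'n)))"
    using cos_converges[of s] sin_converges[of s]
    by (intro sums_add bounded_linear.sums[OF bounded_linear_scaleR_left]) simp_all
  then show ?thesis unfolding matrix_exp_def J_matrix_power by (rule sums_unique[symmetric])
qed

text \<open>For orthogonal \<open>A\<close> both diagonal blocks of \<open>Psi A\<close> are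
  \<open>A\<close>. The equations say that \<open>u + i w\<close> is a complex eigenvector of
  \<open>A\<close> with eigenvalue \<open>cos s + i sin s\<close>, written in real terms.\<close>

lemma det_Psi_eq_0_iff:
  fixes A :: "real^'n^'n"
  assumes A: "orthogonal_matrix A"
  shows "det (Psi A - matrix_exp (s *\<^sub>R J_matrix)) = 0 \<longleftrightarrow>
    (\<exists>u w. (u \<noteq> 0 \<or> w \<noteq> 0) \<and> A *v u = cos s *\<^sub>R u - sin s *\<^sub>R w \<and> A *v w = sin s *\<^sub>R u + cos s *\<^sub>R w)"
proof -
  let ?M = "Psi A - matrix_exp (s *\<^sub>R J_matrix)"
  have inv: "matrix_inv (transpose A) = A"
  proof -
    have "\<exists>B. transpose A ** B = mat 1 \<and> B ** transpose A = mat 1"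
      using A unfolding orthogonal_matrix_def by blast
    then have "transpose A ** matrix_inv (transpose A) = mat 1"
      unfolding matrix_inv_def by (rule someI2_ex) simp
    then have "A ** (transpose A ** matrix_inv (transpose A)) = A" by simp
    then show ?thesis using A by (simp add: matrix_mul_assoc orthogonal_matrix_def)
  qed
  have act: "?M *v join u w = join (A *v u - (cos s *\<^sub>R u - sin s *\<^sub>R w)) (A *v w - (sin s *\<^sub>R u + cos s *\<^sub>R w))"
    for u w
    by (simp add: matrix_vector_mult_diff_rdistrib matrix_vector_mult_add_rdistrib matrix_exp_J
        Psi_def inv block_matrix_join J_matrix_join flip: scaleR_matrix_vector_assoc)
      (simp add: join_def vec_eq_iff split: sum.split)
  have "det ?M = 0 \<longleftrightarrow> \<not> invertible ?M" by (simp add: invertible_det_nz)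
  also have "\<dots> \<longleftrightarrow> (\<exists>x. x \<noteq> 0 \<and> ?M *v x = 0)"
    using matrix_left_invertible_ker[of ?M] by (auto simp: invertible_left_inverse)
  also have "\<dots> \<longleftrightarrow> (\<exists>u w. join u w \<noteq> 0 \<and> ?M *v join u w = 0)" by (metis join_surj)
  finally show ?thesis by (simp add: act join_eq_0_iff)
qed

text \<open>The transpose is the inverse of \<open>A\<close>, so on a complex eigenvector the sum
  acts as \<open>exp (i s) + exp (- i s) = 2 cos s\<close>; real and imaginary parts inherit this
  eigenvalue.\<close>

lemma symmetric_part_eigenvector:
  fixes A :: "real^'n^'n"
  assumes A: "orthogonal_matrix A"
    and u: "A *v u = cos s *\<^sub>R u - sin s *\<^sub>R w" and w: "A *v w = sin s *\<^sub>R u + cos s *\<^sub>R w"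
  shows "A *v u + transpose A *v u = (2 * cos s) *\<^sub>R u"
    "A *v w + transpose A *v w = (2 * cos s) *\<^sub>R w"
proof -
  have TA: "transpose A *v (A *v x) = x" for x
    using A by (simp add: orthogonal_matrix_def matrix_vector_mul_assoc)
  \<comment> \<open>Applying the transpose to the hypotheses gives a linear system for
    \<open>U\<close> and \<open>W\<close> whose matrix is the rotation by \<open>s\<close>; it is
    solved by the opposite rotation.\<close>
  obtain U W where U: "transpose A *v u = U" and W: "transpose A *v w = W" by blast
  have 1: "u = cos s *\<^sub>R U - sin s *\<^sub>R W"
    using TA[of u] unfolding u
    by (simp add: matrix_vector_mult_diff_distrib matrix_vector_mult_scaleR U W del: transpose_matrix_vector)
  have 2: "w = sin s *\<^sub>R U + cos s *\<^sub>R W"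
    using TA[of w] unfolding w
    by (simp add: matrix_vector_right_distrib matrix_vector_mult_scaleR U W del: transpose_matrix_vector)
  have cs: "sin s * sin s + cos s * cos s = 1"
    by (metis power2_eq_square sin_cos_squared_add)
  have "cos s *\<^sub>R u + sin s *\<^sub>R w = (sin s * sin s + cos s * cos s) *\<^sub>R U"
    by (subst 1, subst 2) (simp add: algebra_simps del: sin_cos_squared_add3)
  also have "\<dots> = U" by (simp only: cs scaleR_one)
  finally have "U = cos s *\<^sub>R u + sin s *\<^sub>R w" by simp
  then show "A *v u + transpose A *v u = (2 * cos s) *\<^sub>R u"
    unfolding U u mult_2 scaleR_left_distrib by simp
  have "cos s *\<^sub>R w - sin s *\<^sub>R u = (sin s * sin s + cos s * cos s) *\<^sub>R W"
    by (subst 1, subst 2) (simp add: algebra_simps del: sin_cos_squared_add3)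
  also have "\<dots> = W" by (simp only: cs scaleR_one)
  finally have "W = cos s *\<^sub>R w - sin s *\<^sub>R u" by simp
  then show "A *v w + transpose A *v w = (2 * cos s) *\<^sub>R w"
    unfolding W w mult_2 scaleR_left_distrib by simp
qed

lemma cos_eq_1_imp_2pi:
  assumes "0 < s" "s \<le> 2 * pi" "cos s = 1"
  shows "s = 2 * pi"
proof -
  obtain k :: int where k: "s = of_int k * 2 * pi" using assms(3) cos_one_2pi_int by auto
  have "0 < of_int k * (2 * pi)" "of_int k * (2 * pi) \<le> 1 * (2 * pi)" using k assms by simp_all
  then have "0 < (of_int k :: real)" "of_int k \<le> (1 :: real)"
    using mult_le_cancel_right_pos[of "2 * pi" "of_int k" 1] by (simp_all add: zero_less_mult_iff)
  then have "k = 1" by linarith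
  then show ?thesis using k by simp
qed

text \<open>The only eigenvalue is 1, and the angle 0 is excluded, so the first admissible angle is
  a full turn.\<close>

lemma t_min_Psi_id: "t_min (Psi (mat 1 :: real^'n^'n)) = 2 * pi"
  unfolding t_min_def
proof (rule Least_equality)
  have I: "orthogonal_matrix (mat 1 :: real^'n^'n)" by (rule orthogonal_matrix_id)
  have "det (Psi (mat 1 :: real^'n^'n) - matrix_exp ((2 * pi) *\<^sub>R J_matrix)) = 0"
    \<comment> \<open>The witness for \<open>u\<close> is the all-ones vector; at a full turn any
      nonzero pair would do.\<close>
    unfolding det_Psi_eq_0_iff[OF I] by (rule exI[of _ 1]) auto
  then show "0 < 2 * pi \<and> 2 * pi \<le> 2 * pi \<and> det (Psi (mat 1 :: real^'n^'n) - matrix_exp ((2 * pi) *\<^sub>R J_matrix)) = 0"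
    by simp
  fix s assume s: "0 < s \<and> s \<le> 2 * pi \<and> det (Psi (mat 1 :: real^'n^'n) - matrix_exp (s *\<^sub>R J_matrix)) = 0"
  then obtain u w where nz: "(u :: real^'n) \<noteq> 0 \<or> w \<noteq> 0"
    and e: "mat 1 *v u = cos s *\<^sub>R u - sin s *\<^sub>R w" "mat 1 *v w = sin s *\<^sub>R u + cos s *\<^sub>R w"
    unfolding det_Psi_eq_0_iff[OF I] by blast
  have "2 *\<^sub>R u = (2 * cos s) *\<^sub>R u" "2 *\<^sub>R w = (2 * cos s) *\<^sub>R w"
    using symmetric_part_eigenvector[OF I e] by (simp_all add: scaleR_2 transpose_mat)
  then have "cos s = 1" using nz by auto
  then show "2 * pi \<le> s" using cos_eq_1_imp_2pi[of s] s by auto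
qed

section \<open>The Rayleigh quotient of an orthogonal matrix off its fixed space\<close>

text \<open>The first-order condition at a maximum, applied below to a perturbation of size
  \<open>e\<close>.\<close>

lemma linear_le_quadratic_imp_zero:
  fixes a b :: real
  assumes "\<And>e. e * a + e\<^sup>2 * b \<le> 0"
  shows "a = 0"
proof (rule ccontr)
  assume a: "a \<noteq> 0"
  \<comment> \<open>Small enough for the linear term to beat the quadratic one: \<open>e * a\<close>
    equals \<open>e\<^sup>2 * (1 + \<bar>b\<bar>)\<close>.\<close>
  define e where "e = a / (1 + \<bar>b\<bar>)"
  have e: "e * (1 + \<bar>b\<bar>) = a" by (simp add: e_def)
  have "e \<noteq> 0" using a by (simp add: e_def)
  have "e * a + e\<^sup>2 * b = e\<^sup>2 * (1 + \<bar>b\<bar> + b)"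
    unfolding e[symmetric] by (simp add: power2_eq_square algebra_simps)
  moreover have "e\<^sup>2 * (1 + \<bar>b\<bar> + b) > 0" using \<open>e \<noteq> 0\<close> by (intro mult_pos_pos) auto
  ultimately show False using assms[of e] by simp
qed

lemma orthogonal_matrix_inner:
  fixes A :: "real^'n^'n"
  assumes "orthogonal_matrix A"
  shows "(A *v x) \<bullet> (A *v y) = x \<bullet> y"
proof -
  have "(A *v x) \<bullet> (A *v y) = x \<bullet> (transpose A *v (A *v y))"
    by (metis dot_lmul_matrix inner_commute transpose_matrix_vector)
  then show ?thesis
    using assms by (simp add: orthogonal_matrix_def matrix_vector_mul_assoc del: transpose_matrix_vector)
qed

text \<open>The complement \<open>W\<close> of the fixed space is invariant under \<open>A\<close>
  and its transpose, and nonzero as \<open>A\<close> is not the identity. The quadratic form attains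
  its maximum on the unit sphere of \<open>W\<close>, and stationarity there is the eigenvector
  equation for the symmetric part.\<close>

lemma rayleigh_maximizer:
  fixes A :: "real^'n^'n"
  assumes A: "orthogonal_matrix A" "A \<noteq> mat 1"
  defines "W \<equiv> orthogonal_comp {x. A *v x = x}"
  obtains y \<mu> where "y \<in> W" "norm y = 1" "\<And>z. z \<in> W \<Longrightarrow> z \<bullet> (A *v z) \<le> \<mu> * (z \<bullet> z)"
    "A *v y + transpose A *v y = (2 * \<mu>) *\<^sub>R y" "\<mu> = y \<bullet> (A *v y)"
proof -
  define F where "F = {x. A *v x = x}"
  have W: "W = {y. \<forall>f\<in>F. f \<bullet> y = 0}"
    by (simp add: W_def F_def orthogonal_comp_def orthogonal_def)
  have subF: "subspace F"
    by (auto simp: F_def subspace_def matrix_vector_right_distrib matrix_vector_mult_scaleR)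
  have subW: "subspace W" unfolding W_def by (rule subspace_orthogonal_comp)
  have adj: "x \<bullet> (transpose A *v y) = (A *v x) \<bullet> y" for x y
    by (metis dot_lmul_matrix inner_commute transpose_matrix_vector)
  note iso = orthogonal_matrix_inner[OF A(1)]
  have invW: "A *v y \<in> W" "transpose A *v y \<in> W" if "y \<in> W" for y
  proof -
    have "f \<bullet> (A *v y) = 0 \<and> f \<bullet> (transpose A *v y) = 0" if f: "f \<in> F" for f
    proof -
      have "A *v f = f" "f \<bullet> y = 0" using f \<open>y \<in> W\<close> by (simp_all add: F_def W)
      then show ?thesis using iso[of f y] adj[of f y] by simp
    qed
    then show "A *v y \<in> W" "transpose A *v y \<in> W" unfolding W by blast+
  qed
  define K where "K = W \<inter> sphere 0 1"
  have "closed W" using subW by (rule closed_subspace)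
  then have "compact K" by (simp add: K_def closed_Int_compact)
  moreover have "K \<noteq> {}"
  proof -
    obtain x where x: "A *v x \<noteq> x" using A(2) by (metis matrix_eq matrix_vector_mul_lid)
    obtain f z where fz: "f \<in> span F" "\<And>w. w \<in> span F \<Longrightarrow> orthogonal z w" "x = f + z"
      using orthogonal_subspace_decomp_exists by blast
    have "f \<in> F" using fz(1) subF by (metis span_eq_iff)
    then have "z \<noteq> 0" using fz(3) x by (auto simp: F_def)
    have "z \<in> W" using fz(2) by (auto simp: W orthogonal_def inner_commute span_base)
    then have "z /\<^sub>R norm z \<in> K" using \<open>z \<noteq> 0\<close> subW by (simp add: K_def subspace_scale)
    then show ?thesis by blast
  qed
  moreover have "continuous_on K (\<lambda>y. y \<bullet> (A *v y))"
    by (intro continuous_intros matrix_vector_mult_linear_continuous_on)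
  ultimately obtain y where y: "y \<in> K" and max: "\<And>z. z \<in> K \<Longrightarrow> z \<bullet> (A *v z) \<le> y \<bullet> (A *v y)"
    using continuous_attains_sup by metis
  define \<mu> where "\<mu> = y \<bullet> (A *v y)"
  have yW: "y \<in> W" "norm y = 1" using y by (simp_all add: K_def)
  have le: "z \<bullet> (A *v z) \<le> \<mu> * (z \<bullet> z)" if "z \<in> W" for z
  proof (cases "z = 0")
    case False
    then have "z /\<^sub>R norm z \<in> K" using that subW by (simp add: K_def subspace_scale)
    from max[OF this] have "(z \<bullet> (A *v z)) / (norm z)\<^sup>2 \<le> \<mu>"
      by (simp add: \<mu>_def matrix_vector_mult_scaleR power2_eq_square divide_simps)
    then show ?thesis using False by (simp add: divide_simps power2_norm_eq_inner)
  qed simp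
  \<comment> \<open>\<open>h\<close> is the gradient at \<open>y\<close> of the Rayleigh quotient, and lies in \<open>W\<close>.\<close>
  define h where "h = A *v y + transpose A *v y - (2 * \<mu>) *\<^sub>R y"
  have hW: "h \<in> W" unfolding h_def using subW invW yW
    by (intro subspace_diff subspace_add subspace_scale)
  \<comment> \<open>Moving from \<open>y\<close> to \<open>y + e *\<^sub>R h\<close> inside
    \<open>W\<close> cannot violate \<open>le\<close>, and the first-order coefficient of this
    variation is h \<bullet> h.\<close>
  have "h \<bullet> h = 0"
  proof (rule linear_le_quadratic_imp_zero)
    fix e :: real
    have 1: "(y + e *\<^sub>R h) \<bullet> (A *v (y + e *\<^sub>R h)) \<le> \<mu> * ((y + e *\<^sub>R h) \<bullet> (y + e *\<^sub>R h))"
      using subW hW yW by (intro le subspace_add subspace_scale)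
    have yy: "y \<bullet> y = 1" using yW(2) by (simp add: dot_square_norm)
    have yh: "y \<bullet> (A *v h) = h \<bullet> (transpose A *v y)" using adj[of h y] by (simp add: inner_commute)
    have E1: "(y + e *\<^sub>R h) \<bullet> (A *v (y + e *\<^sub>R h)) = \<mu> + e * (h \<bullet> (A *v y + transpose A *v y)) + e\<^sup>2 * (h \<bullet> (A *v h))"
      by (simp add: \<mu>_def matrix_vector_right_distrib matrix_vector_mult_scaleR inner_add yh power2_eq_square
          algebra_simps del: transpose_matrix_vector)
    have E2: "(y + e *\<^sub>R h) \<bullet> (y + e *\<^sub>R h) = 1 + e * (2 * (h \<bullet> y)) + e\<^sup>2 * (h \<bullet> h)"
      by (simp add: inner_add inner_commute yy power2_eq_square algebra_simps)
    have "e * (h \<bullet> (A *v y + transpose A *v y)) + e\<^sup>2 * (h \<bullet> (A *v h))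
        \<le> e * (2 * \<mu> * (h \<bullet> y)) + e\<^sup>2 * (\<mu> * (h \<bullet> h))"
      using 1 unfolding E1 E2 by (simp only: algebra_simps mult_1_right add_le_cancel_left)
    moreover have "h \<bullet> h = h \<bullet> (A *v y + transpose A *v y) - 2 * \<mu> * (h \<bullet> y)"
      by (subst (2) h_def) (simp only: inner_diff_right inner_scaleR_right)
    then have "e * (h \<bullet> h) = e * (h \<bullet> (A *v y + transpose A *v y)) - e * (2 * \<mu> * (h \<bullet> y))"
      by (simp only: right_diff_distrib)
    ultimately show "e * (h \<bullet> h) + e\<^sup>2 * (h \<bullet> (A *v h) - \<mu> * (h \<bullet> h)) \<le> 0"
      unfolding right_diff_distrib[of "e\<^sup>2"] by linarith
  qed
  then have "h = 0" by (simp only: inner_eq_zero_iff)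
  then have "A *v y + transpose A *v y = (2 * \<mu>) *\<^sub>R y" unfolding h_def by (simp only: right_minus_eq)
  from that[OF yW le this \<mu>_def] show ?thesis .
qed

text \<open>The angle is \<theta> = arccos \<mu>, with \<mu> the maximum of the Rayleigh quotient.
  The maximizer yields a complex eigenvector of angle \<theta>. A smaller angle \<open>s\<close>
  would give an eigenvector of the symmetric part orthogonal to the fixed space, with Rayleigh
  quotient \<open>cos s\<close> above \<mu>.\<close>

lemma t_min_Psi_gap:
  fixes A :: "real^'n^'n"
  assumes A: "orthogonal_matrix A" "A \<noteq> mat 1"
  defines "t \<equiv> t_min (Psi A)"
  shows "0 < t" "t \<le> pi"
    and "z \<in> orthogonal_comp {x. A *v x = x} \<Longrightarrow> z \<bullet> (A *v z) \<le> cos t * (z \<bullet> z)"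
proof -
  obtain y \<mu> where y: "y \<in> orthogonal_comp {x. A *v x = x}" "norm y = 1"
    and le: "\<And>z. z \<in> orthogonal_comp {x. A *v x = x} \<Longrightarrow> z \<bullet> (A *v z) \<le> \<mu> * (z \<bullet> z)"
    and eig: "A *v y + transpose A *v y = (2 * \<mu>) *\<^sub>R y" and \<mu>: "\<mu> = y \<bullet> (A *v y)"
    by (rule rayleigh_maximizer[OF A]) (rule that; assumption)
  have adj: "x \<bullet> (transpose A *v y) = (A *v x) \<bullet> y" for x y
    by (metis dot_lmul_matrix inner_commute transpose_matrix_vector)
  note iso = orthogonal_matrix_inner[OF A(1)]
  have nA: "norm (A *v x) = norm x" for x by (simp add: norm_eq_sqrt_inner iso)
  have "\<bar>\<mu>\<bar> \<le> 1" using Cauchy_Schwarz_ineq2[of y "A *v y"] by (simp add: \<mu> nA y)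
  have "y \<noteq> 0" using y by auto
  have yy: "y \<bullet> y = 1" using y(2) by (simp add: dot_square_norm)
  have "\<mu> \<noteq> 1"
  proof
    assume "\<mu> = 1"
    moreover have "(A *v y - y) \<bullet> (A *v y - y) = 2 - 2 * \<mu>"
      by (simp add: inner_diff iso inner_commute[of "A *v y"] \<mu> yy)
    ultimately have "A *v y = y" by simp
    then have "y \<bullet> y = 0" using y(1) by (simp add: orthogonal_comp_def orthogonal_def)
    then show False using \<open>y \<noteq> 0\<close> by simp
  qed
  define \<theta> where "\<theta> = arccos \<mu>"
  have \<theta>: "cos \<theta> = \<mu>" "0 < \<theta>" "\<theta> \<le> pi"
  proof -
    show "cos \<theta> = \<mu>" unfolding \<theta>_def using \<open>\<bar>\<mu>\<bar> \<le> 1\<close> by (rule cos_arccos_abs)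
    then have "\<theta> \<noteq> 0" using \<open>\<mu> \<noteq> 1\<close> by auto
    moreover have "0 \<le> \<theta>" "\<theta> \<le> pi"
      unfolding \<theta>_def using \<open>\<bar>\<mu>\<bar> \<le> 1\<close> by (auto intro: arccos_lbound arccos_ubound)
    ultimately show "0 < \<theta>" "\<theta> \<le> pi" by simp_all
  qed
  have AT: "A *v (transpose A *v x) = x" for x
    using A(1) by (simp add: orthogonal_matrix_def matrix_vector_mul_assoc del: transpose_matrix_vector)
  have AAy: "A *v (A *v y) = (2 * \<mu>) *\<^sub>R (A *v y) - y"
    using arg_cong[OF eig, of "(*v) A"]
    by (simp add: matrix_vector_right_distrib matrix_vector_mult_scaleR AT eq_diff_eq del: transpose_matrix_vector)
  \<comment> \<open>If the sine vanishes, \<theta> is \<pi>, \<open>A\<close> maps \<open>y\<close>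
    to \<open>- y\<close>, and \<open>w = 0\<close> works. Otherwise the first equation determines
    \<open>w\<close>, and the second follows from the recurrence \<open>AAy\<close>.\<close>
  have "\<exists>w. A *v y = cos \<theta> *\<^sub>R y - sin \<theta> *\<^sub>R w \<and> A *v w = sin \<theta> *\<^sub>R y + cos \<theta> *\<^sub>R w"
  proof (cases "sin \<theta> = 0")
    case True
    then have "\<theta> = pi" using \<theta> sin_gt_zero[of \<theta>] by fastforce
    then have "\<mu> = -1" using \<theta> by simp
    moreover have "(A *v y + y) \<bullet> (A *v y + y) = 2 + 2 * \<mu>"
      by (simp add: inner_add iso inner_commute[of "A *v y"] \<mu> yy)
    ultimately have "(A *v y + y) \<bullet> (A *v y + y) = 0" by simp
    then have "A *v y + y = 0" by (simp only: inner_eq_zero_iff)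
    then have "A *v y = - y" by (simp add: eq_neg_iff_add_eq_0)
    then show ?thesis using \<open>\<theta> = pi\<close> by (intro exI[of _ 0]) simp
  next
    case False
    define w where "w = (cos \<theta> *\<^sub>R y - A *v y) /\<^sub>R sin \<theta>"
    have w: "sin \<theta> *\<^sub>R w = cos \<theta> *\<^sub>R y - A *v y" using False by (simp add: w_def)
    have cs: "sin \<theta> * sin \<theta> = 1 - cos \<theta> * cos \<theta>"
      by (metis power2_eq_square sin_squared_eq)
    have "sin \<theta> *\<^sub>R (A *v w) = A *v (cos \<theta> *\<^sub>R y - A *v y)"
      by (simp flip: w add: matrix_vector_mult_scaleR)
    also have "\<dots> = cos \<theta> *\<^sub>R (A *v y) - ((2 * \<mu>) *\<^sub>R (A *v y) - y)"
      by (simp add: matrix_vector_mult_diff_distrib matrix_vector_mult_scaleR AAy)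
    also have "\<dots> = y - cos \<theta> *\<^sub>R (A *v y)"
    proof -
      have "b - (b + b - y) = y - b" for b by simp
      then show ?thesis unfolding \<theta>(1) mult_2 scaleR_left_distrib .
    qed
    also have "\<dots> = (sin \<theta> * sin \<theta>) *\<^sub>R y + cos \<theta> *\<^sub>R (cos \<theta> *\<^sub>R y - A *v y)"
      unfolding cs by (simp add: scaleR_left_diff_distrib scaleR_right_diff_distrib)
    also have "\<dots> = sin \<theta> *\<^sub>R (sin \<theta> *\<^sub>R y + cos \<theta> *\<^sub>R w)"
      by (simp flip: w add: algebra_simps)
    finally have "A *v w = sin \<theta> *\<^sub>R y + cos \<theta> *\<^sub>R w" using False by simp
    then show ?thesis using w by (intro exI[of _ w]) simp
  qed
  then have root: "det (Psi A - matrix_exp (\<theta> *\<^sub>R J_matrix)) = 0"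
    unfolding det_Psi_eq_0_iff[OF A(1)] using \<open>y \<noteq> 0\<close> by blast
  have "t = \<theta>"
    unfolding t_def t_min_def
  proof (rule Least_equality)
    show "0 < \<theta> \<and> \<theta> \<le> 2 * pi \<and> det (Psi A - matrix_exp (\<theta> *\<^sub>R J_matrix)) = 0"
      using \<theta> root by simp
    fix s assume s: "0 < s \<and> s \<le> 2 * pi \<and> det (Psi A - matrix_exp (s *\<^sub>R J_matrix)) = 0"
    then obtain u w where nz: "u \<noteq> 0 \<or> w \<noteq> 0"
      and e: "A *v u = cos s *\<^sub>R u - sin s *\<^sub>R w" "A *v w = sin s *\<^sub>R u + cos s *\<^sub>R w"
      unfolding det_Psi_eq_0_iff[OF A(1)] by blast
    show "\<theta> \<le> s"
    proof (rule ccontr)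
      assume "\<not> \<theta> \<le> s"
      then have sl: "s < \<theta>" by simp
      then have cs: "cos s > \<mu>" using cos_monotone_0_pi[of s \<theta>] s \<theta> by simp
      have c1: "cos s \<noteq> 1" using cos_monotone_0_pi[of 0 s] s sl \<theta> by simp
      \<comment> \<open>Fixed vectors are eigenvectors of the symmetric sum with eigenvalue 2, so
        \<open>v\<close>, having another eigenvalue, is orthogonal to them and \<open>le\<close>
        applies.\<close>
      have zero: "v = 0" if v: "A *v v + transpose A *v v = (2 * cos s) *\<^sub>R v" for v
      proof -
        have "f \<bullet> v = 0" if f: "A *v f = f" for f
        proof -
          have "f \<bullet> (A *v v) = f \<bullet> v" using iso[of f v] f by simp
          moreover have "f \<bullet> (transpose A *v v) = f \<bullet> v" using adj[of f v] f by simp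
          ultimately have "2 * (f \<bullet> v) = 2 * cos s * (f \<bullet> v)"
            using arg_cong[OF v, of "\<lambda>x. f \<bullet> x"] by (simp add: inner_add_right del: transpose_matrix_vector)
          then show ?thesis using c1 by simp
        qed
        then have "v \<in> orthogonal_comp {x. A *v x = x}" by (simp add: orthogonal_comp_def orthogonal_def)
        from le[OF this] have 1: "v \<bullet> (A *v v) \<le> \<mu> * (v \<bullet> v)" .
        have "v \<bullet> (A *v v) + v \<bullet> (transpose A *v v) = 2 * cos s * (v \<bullet> v)"
          using arg_cong[OF v, of "\<lambda>x. v \<bullet> x"] by (simp add: inner_add_right del: transpose_matrix_vector)
        then have "v \<bullet> (A *v v) = cos s * (v \<bullet> v)"
          using adj[of v v] by (simp add: inner_commute del: transpose_matrix_vector)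
        then have "(cos s - \<mu>) * (v \<bullet> v) \<le> 0" using 1 by (simp add: algebra_simps)
        then have "v \<bullet> v \<le> 0" using cs by (simp add: mult_le_0_iff)
        then show ?thesis by (metis inner_eq_zero_iff inner_ge_zero order_antisym)
      qed
      show False using nz zero symmetric_part_eigenvector[OF A(1) e] by blast
    qed
  qed
  then show "0 < t" "t \<le> pi"
    "z \<in> orthogonal_comp {x. A *v x = x} \<Longrightarrow> z \<bullet> (A *v z) \<le> cos t * (z \<bullet> z)"
    using \<theta> le by simp_all
qed

section \<open>Billiard trajectories\<close>

text \<open>The velocity is constant inside the interval, so the one-sided limits are those of
  eventually constant functions; continuity carries the displacement formula to the end
  points.\<close>

lemma affine_piece:
  fixes \<sigma> :: "real \<Rightarrow> 'a::euclidean_space"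
  assumes ab: "a < b" and cont: "continuous_on {a..b} \<sigma>"
    and d: "\<And>t. t \<in> {a<..<b} \<Longrightarrow> \<sigma> differentiable (at t)"
    and d2: "\<And>t. t \<in> {a<..<b} \<Longrightarrow> (velocity \<sigma> has_vector_derivative 0) (at t)"
  shows "\<sigma> b - \<sigma> a = (b - a) *\<^sub>R vel_plus \<sigma> a" and "vel_minus \<sigma> b = vel_plus \<sigma> a"
proof -
  obtain v where v: "\<And>t. t \<in> {a<..<b} \<Longrightarrow> velocity \<sigma> t = v"
    using has_vector_derivative_zero_constant[of "{a<..<b}" "velocity \<sigma>"] d2
    by (metis convex_real_interval(8) has_vector_derivative_at_within)
  have dv: "(\<sigma> has_vector_derivative v) (at t)" if "t \<in> {a<..<b}" for t
    using d[OF that] v[OF that] by (simp add: velocity_def vector_derivative_works)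
  have "\<sigma> b - b *\<^sub>R v = \<sigma> a - a *\<^sub>R v"
  proof (rule has_derivative_zero_unique_strong_interval[where k = "{a, b}" and f = "\<lambda>t. \<sigma> t - t *\<^sub>R v" and a = a and b = b])
    show "continuous_on {a..b} (\<lambda>t. \<sigma> t - t *\<^sub>R v)" by (intro continuous_intros cont)
    fix t assume "t \<in> {a..b} - {a, b}"
    then have "(\<sigma> has_vector_derivative v) (at t)" using dv by auto
    then have "(\<sigma> has_derivative (\<lambda>h. h *\<^sub>R v)) (at t within {a..b})"
      unfolding has_vector_derivative_def by (rule has_derivative_at_withinI)
    then show "((\<lambda>t. \<sigma> t - t *\<^sub>R v) has_derivative (\<lambda>h. 0)) (at t within {a..b})"
      by (auto intro!: derivative_eq_intros)
  qed (use ab in auto)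
  moreover have "vel_plus \<sigma> a = v"
    unfolding vel_plus_def
  proof (intro tendsto_Lim tendsto_eventually)
    show "\<forall>\<^sub>F t in at_right a. velocity \<sigma> t = v"
      unfolding eventually_at_right_field using ab v by (intro exI[of _ b]) auto
  qed simp
  moreover have "vel_minus \<sigma> b = v"
    unfolding vel_minus_def
  proof (intro tendsto_Lim tendsto_eventually)
    show "\<forall>\<^sub>F t in at_left b. velocity \<sigma> t = v"
      unfolding eventually_at_left_field using ab v by (intro exI[of _ a]) auto
  qed simp
  ultimately show "\<sigma> b - \<sigma> a = (b - a) *\<^sub>R vel_plus \<sigma> a" "vel_minus \<sigma> b = vel_plus \<sigma> a"
    by (simp_all add: algebra_simps)
qed

section \<open>Reflection at the boundary\<close>

text \<open>The open ball contains \<open>c + s *\<^sub>R \<nu>\<close> for every positive s < r;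
  let \<open>s\<close> tend to \<open>r\<close>.\<close>

lemma ball_subset_imp_support_ge:
  assumes "ball c r \<subseteq> \<Omega>" "r > 0" "outer_normal \<Omega> x \<nu>"
  shows "r \<le> \<nu> \<bullet> (x - c)"
proof (rule dense_le_bounded[of 0])
  fix s assume s: "0 < s" "s < r"
  have n: "norm \<nu> = 1" using assms(3) by (simp add: outer_normal_def)
  then have "c + s *\<^sub>R \<nu> \<in> \<Omega>" using s assms(1) by (auto simp: dist_norm)
  then have "\<nu> \<bullet> (c + s *\<^sub>R \<nu> - x) \<le> 0" using assms(3) by (simp add: outer_normal_def)
  then show "s \<le> \<nu> \<bullet> (x - c)"
    using n by (simp add: inner_diff_right inner_add_right dot_square_norm)
qed fact

text \<open>The incoming velocity is \<open>v\<close>, the outgoing one \<open>v'\<close>. Equality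
  of the two, possible for tangential velocities, is allowed, as in the conventions for the end
  points.\<close>

definition bounces :: "'a::euclidean_space set \<Rightarrow> 'a \<Rightarrow> 'a \<Rightarrow> 'a \<Rightarrow> bool" where
  "bounces \<Omega> x v v' \<longleftrightarrow> v' + v \<in> tangent_space (frontier \<Omega>) x \<and>
     v' - v \<in> orthogonal_comp (tangent_space (frontier \<Omega>) x)"

text \<open>The relation is the graph of the orthogonal reflection in the tangent hyperplane. Hence
  it is symmetric and functional, which makes the \<open>THE\<close> terms at the end points
  meaningful.\<close>

lemma bounces_iff:
  assumes "smooth_convex_body \<Omega>" "x \<in> frontier \<Omega>" "outer_normal \<Omega> x \<nu>"
  shows "bounces \<Omega> x v v' \<longleftrightarrow> v' = v - (2 * (\<nu> \<bullet> v)) *\<^sub>R \<nu>"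
proof -
  have n: "norm \<nu> = 1" using assms(3) by (simp add: outer_normal_def)
  then have nn: "\<nu> \<bullet> \<nu> = 1" by (simp add: dot_square_norm)
  have "bounces \<Omega> x v v' \<longleftrightarrow> \<nu> \<bullet> (v' + v) = 0 \<and> v' - v = (\<nu> \<bullet> (v' - v)) *\<^sub>R \<nu>"
    unfolding bounces_def tangent_space_eq_normal_complement[OF assms] orthogonal_comp_hyperplane[OF n]
    by simp
  also have "\<dots> \<longleftrightarrow> v' = v - (2 * (\<nu> \<bullet> v)) *\<^sub>R \<nu>"
  proof
    assume h: "\<nu> \<bullet> (v' + v) = 0 \<and> v' - v = (\<nu> \<bullet> (v' - v)) *\<^sub>R \<nu>"
    then have "\<nu> \<bullet> v' = - (\<nu> \<bullet> v)" by (simp add: inner_add_right)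
    then have "\<nu> \<bullet> (v' - v) = - (2 * (\<nu> \<bullet> v))" by (simp add: inner_diff_right)
    then have "v' - v = (- (2 * (\<nu> \<bullet> v))) *\<^sub>R \<nu>" using h by metis
    then show "v' = v - (2 * (\<nu> \<bullet> v)) *\<^sub>R \<nu>" by (simp add: algebra_simps)
  qed (simp add: inner_add_right inner_diff_right nn)
  finally show ?thesis .
qed

lemma bounces_sym:
  assumes "smooth_convex_body \<Omega>" "x \<in> frontier \<Omega>"
  shows "bounces \<Omega> x v v' \<longleftrightarrow> bounces \<Omega> x v' v"
proof -
  obtain \<nu> where \<nu>: "outer_normal \<Omega> x \<nu>"
    using assms outer_normal_exists unfolding smooth_convex_body_def by blast
  then have "\<nu> \<bullet> \<nu> = 1" by (simp add: outer_normal_def dot_square_norm)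
  then show ?thesis
    unfolding bounces_iff[OF assms \<nu>] by (auto simp: inner_diff_right)
qed

lemma bounces_ex1:
  assumes "smooth_convex_body \<Omega>" "x \<in> frontier \<Omega>"
  shows "\<exists>!v'. bounces \<Omega> x v v'"
proof -
  obtain \<nu> where "outer_normal \<Omega> x \<nu>"
    using assms outer_normal_exists unfolding smooth_convex_body_def by blast
  then show ?thesis using bounces_iff[OF assms] by simp
qed

text \<open>Trivially true for \<open>v = v'\<close>, so that an end point without bounce needs no separate treatment.\<close>

definition inward_jump :: "'a::euclidean_space \<Rightarrow> real \<Rightarrow> 'a \<Rightarrow> 'a \<Rightarrow> 'a \<Rightarrow> bool" where
  "inward_jump c r x v v' \<longleftrightarrow> norm v = norm v' \<and> r * norm (v' - v) \<le> (x - c) \<bullet> (v - v')"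

text \<open>The jump is \<open>- 2 * a\<close> times \<nu>, with a \<ge> 0 because a straight
  segment at \<open>x\<close> stays in \<Omega>. One segment suffices: at the start only the
  outgoing one belongs to the path, at the end only the incoming one.\<close>

lemma bounces_imp_inward_jump:
  assumes \<Omega>: "smooth_convex_body \<Omega>" "ball c r \<subseteq> \<Omega>" "r > 0"
    and x: "x \<in> frontier \<Omega>" and b: "bounces \<Omega> x v v'"
    and s: "s > 0" and inside: "x - s *\<^sub>R v \<in> \<Omega> \<or> x + s *\<^sub>R v' \<in> \<Omega>"
  shows "inward_jump c r x v v'"
proof -
  obtain \<nu> where \<nu>: "outer_normal \<Omega> x \<nu>"
    using \<Omega> x outer_normal_exists unfolding smooth_convex_body_def by blast
  have n: "norm \<nu> = 1" using \<nu> by (simp add: outer_normal_def)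
  then have nn: "\<nu> \<bullet> \<nu> = 1" by (simp add: dot_square_norm)
  define a where "a = \<nu> \<bullet> v"
  have v': "v' = v - (2 * a) *\<^sub>R \<nu>" using b unfolding bounces_iff[OF \<Omega>(1) x \<nu>] a_def .
  have "a \<ge> 0"
    using inside
  proof
    assume "x - s *\<^sub>R v \<in> \<Omega>"
    then have "\<nu> \<bullet> (x - s *\<^sub>R v - x) \<le> 0" using \<nu> unfolding outer_normal_def by blast
    then show ?thesis using s by (simp add: a_def inner_diff_right zero_le_mult_iff)
  next
    assume "x + s *\<^sub>R v' \<in> \<Omega>"
    then have "\<nu> \<bullet> (x + s *\<^sub>R v' - x) \<le> 0" using \<nu> unfolding outer_normal_def by blast
    then have "s * (a - 2 * a) \<le> 0" by (simp add: v' a_def inner_diff_right nn)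
    then show ?thesis using s by (simp add: zero_le_mult_iff)
  qed
  have "v' \<bullet> v' = v \<bullet> v - 2 * (2 * a) * (\<nu> \<bullet> v) + (2 * a) * (2 * a) * (\<nu> \<bullet> \<nu>)"
    unfolding v' by (simp add: inner_diff inner_commute algebra_simps)
  then have "v' \<bullet> v' = v \<bullet> v" by (simp add: nn flip: a_def)
  then have "norm v = norm v'" by (simp add: norm_eq_sqrt_inner)
  moreover have "r * norm (v' - v) \<le> (x - c) \<bullet> (v - v')"
  proof -
    have "r * norm (v' - v) = (2 * a) * r" using \<open>a \<ge> 0\<close> n by (simp add: v')
    also have "\<dots> \<le> (2 * a) * (\<nu> \<bullet> (x - c))"
      using ball_subset_imp_support_ge[OF \<Omega>(2,3) \<nu>] \<open>a \<ge> 0\<close> by (intro mult_left_mono) auto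
    also have "\<dots> = (x - c) \<bullet> (v - v')" by (simp add: v' inner_commute)
    finally show ?thesis .
  qed
  ultimately show ?thesis by (simp add: inward_jump_def)
qed

lemma vel_before_start_bounces:
  assumes "smooth_convex_body \<Omega>" "\<sigma> 0 \<in> frontier \<Omega>"
  shows "bounces \<Omega> (\<sigma> 0) (vel_before_start \<Omega> \<sigma>) (vel_plus \<sigma> 0)"
  unfolding bounces_def vel_before_start_def
  by (rule theI') (use bounces_ex1[OF assms, of "vel_plus \<sigma> 0"] bounces_sym[OF assms, of "vel_plus \<sigma> 0"]
      in \<open>simp add: bounces_def\<close>)

lemma vel_after_end_bounces:
  assumes "smooth_convex_body \<Omega>" "\<sigma> T \<in> frontier \<Omega>"
  shows "bounces \<Omega> (\<sigma> T) (vel_minus \<sigma> T) (vel_after_end \<Omega> T \<sigma>)"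
  unfolding bounces_def vel_after_end_def
  by (rule theI') (use bounces_ex1[OF assms, of "vel_minus \<sigma> T"] in \<open>simp add: bounces_def\<close>)

section \<open>Lower bound for the variation of the velocity\<close>

text \<open>With \<open>h = u / 2\<close>, both \<open>sin h / h\<close> and \<open>cos h\<close>
  are at least \<open>cos (pi / 4)\<close>, so \<open>sin u = 2 sin h cos h\<close> is at least
  \<open>h\<close>.\<close>

lemma half_le_sin:
  fixes u :: real
  assumes "0 \<le> u" "u \<le> pi / 2"
  shows "u / 2 \<le> sin u"
proof (cases "u = 0")
  case False
  define h where "h = u / 2"
  have h: "0 < h" "h \<le> pi / 4" using assms False by (auto simp: h_def)
  obtain \<xi> where \<xi>: "0 < \<xi>" "\<xi> < h" "sin h - sin 0 = (h - 0) * cos \<xi>"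
    using MVT2[OF h(1), of sin cos] by (auto intro: DERIV_sin)
  have c4: "sqrt 2 / 2 \<le> cos h"
    using cos_monotone_0_pi_le[of h "pi/4"] h by (simp add: cos_45)
  have "cos h \<le> cos \<xi>" using \<xi> h by (intro cos_monotone_0_pi_le) auto
  then have "sqrt 2 / 2 \<le> cos \<xi>" using c4 by simp
  then have "h * (sqrt 2 / 2) \<le> sin h" using \<xi> h by (simp add: mult_left_mono)
  then have "h * (sqrt 2 / 2) * (sqrt 2 / 2) \<le> sin h * cos h"
    using c4 h by (intro mult_mono) (auto intro: sin_ge_zero)
  moreover have "h * (sqrt 2 / 2) * (sqrt 2 / 2) = h / 2" by simp
  ultimately have "h / 2 \<le> sin h * cos h" by (simp only:)
  then show ?thesis using sin_double[of h] by (simp add: h_def)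
qed simp

text \<open>For an isometry the squared displacement is twice
  \<open>y \<bullet> y - y \<bullet> (A *v y)\<close>, which \<open>t_min_Psi_gap\<close> bounds
  below; then \<open>1 - cos t\<close> is twice the squared sine of \<open>t / 2\<close>.\<close>

lemma displacement_ge_on_complement:
  fixes A :: "real^'n^'n"
  assumes A: "orthogonal_matrix A" "A \<noteq> mat 1" and y: "y \<in> orthogonal_comp {x. A *v x = x}"
  shows "2 * sin (t_min (Psi A) / 2) * norm y \<le> norm (A *v y - y)"
proof (rule power2_le_imp_le)
  let ?t = "t_min (Psi A)"
  have nA: "norm (A *v y) = norm y"
    by (simp add: norm_eq_sqrt_inner orthogonal_matrix_inner[OF A(1)])
  have cos: "cos ?t = 1 - 2 * (sin (?t / 2))\<^sup>2" using cos_double_sin[of "?t / 2"] by simp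
  have "(2 * sin (?t / 2) * norm y)\<^sup>2 = 2 * (y \<bullet> y) - 2 * (cos ?t * (y \<bullet> y))"
    unfolding cos by (simp add: power_mult_distrib power2_norm_eq_inner algebra_simps)
  also have "\<dots> \<le> 2 * (y \<bullet> y) - 2 * (y \<bullet> (A *v y))" using t_min_Psi_gap(3)[OF A y] by simp
  also have "\<dots> = (norm (A *v y))\<^sup>2 + (norm y)\<^sup>2 - 2 * (y \<bullet> (A *v y))"
    by (simp add: nA power2_norm_eq_inner)
  also have "\<dots> = (norm (A *v y - y))\<^sup>2"
    by (simp add: power2_norm_eq_inner inner_diff inner_commute)
  finally show "(2 * sin (?t / 2) * norm y)\<^sup>2 \<le> (norm (A *v y - y))\<^sup>2" .
qed simp

text \<open>\<open>drift\<close> holds for trajectories since the sum is the displacement \<open>A q - q\<close>.\<close>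

lemma velocity_variation_ge:
  fixes A :: "real^'n^'n" and p :: "nat \<Rightarrow> real^'n"
  assumes A: "orthogonal_matrix A"
    and sphere: "\<And>j. j \<le> Suc m \<Longrightarrow> norm (p j) = \<omega>"
    and closing: "p (Suc m) = A *v p 0"
    and "m > 0" and \<tau>: "\<And>j. j < m \<Longrightarrow> \<tau> j > 0"
    and drift: "(\<Sum>j<m. \<tau> j *\<^sub>R p (Suc j)) \<in> orthogonal_comp {x. A *v x = x}"
  shows "\<omega> * t_min (Psi A) / 2 \<le> (\<Sum>j\<le>m. norm (p (Suc j) - p j))"
proof -
  have \<omega>: "\<omega> \<ge> 0" using sphere[of 0] norm_ge_zero[of "p 0"] by linarith
  \<comment> \<open>The \<tau>-weighted sum of the velocities is orthogonal to \<open>x\<close> by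
    \<open>drift\<close>, so they cannot all have positive component along \<open>x\<close>. Only
    velocities of actual edges occur, hence \<open>Suc j\<close> with \<open>j < m\<close>.\<close>
  have balanced: "\<exists>j<m. p (Suc j) \<bullet> x \<le> 0" if "A *v x = x" for x
  proof (rule ccontr)
    assume "\<not> ?thesis"
    then have "0 < (\<Sum>j<m. \<tau> j * (p (Suc j) \<bullet> x))"
      using \<open>m > 0\<close> \<tau> by (intro sum_pos) (auto simp: not_le)
    also have "\<dots> = (\<Sum>j<m. \<tau> j *\<^sub>R p (Suc j)) \<bullet> x" by (simp add: inner_sum_left)
    also have "\<dots> = 0" using drift that
      by (simp add: orthogonal_comp_def orthogonal_def inner_commute)
    finally show False by simp
  qed
  show ?thesis
  proof (cases "A = mat 1")
    case True
    have "4 * \<omega> \<le> (\<Sum>j<Suc m. norm (p (Suc j) - p j))"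
    proof (rule closed_spherical_polygon_variation)
      show "p (Suc m) = p 0" using closing True by simp
      show "\<exists>j\<le>Suc m. p j \<bullet> c \<le> 0" for c
        using balanced[of c] True by (metis Suc_leI less_imp_le_nat matrix_vector_mul_lid not_less_eq_eq)
    qed (rule sphere)
    \<comment> \<open>For the identity \<open>t_min\<close> is a full turn, so the required bound is
      \<omega> \<pi>.\<close>
    moreover have "\<omega> * pi \<le> \<omega> * 4" using \<omega> pi_less_4 by (intro mult_left_mono) auto
    ultimately show ?thesis using True t_min_Psi_id[where 'n = 'n] by (simp add: lessThan_Suc_atMost)
  next
    case False
    let ?F = "{x. A *v x = x}" and ?\<kappa> = "2 * sin (t_min (Psi A) / 2)"
    note gap = t_min_Psi_gap[OF A False]
    have subF: "subspace ?F"
      by (auto simp: subspace_def matrix_vector_right_distrib matrix_vector_mult_scaleR)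
    obtain x y where xy: "x \<in> span ?F" "\<And>w. w \<in> span ?F \<Longrightarrow> orthogonal y w" "p 0 = x + y"
      using orthogonal_subspace_decomp_exists by blast
    have x: "A *v x = x" using xy(1) unfolding span_eq_iff[THEN iffD2, OF subF] by simp
    have y: "y \<in> orthogonal_comp ?F"
      using xy(2) by (auto simp: orthogonal_comp_def orthogonal_commute span_base)
    have xy0: "x \<bullet> y = 0" using y x by (simp add: orthogonal_comp_def orthogonal_def)
    have "x \<bullet> (A *v y) = (A *v x) \<bullet> (A *v y)" by (simp add: x)
    also have "\<dots> = x \<bullet> y"
      by (rule orthogonal_matrix_inner[OF A])
    finally have xAy: "x \<bullet> (A *v y) = 0" using xy0 by simp
    \<comment> \<open>This vertex lies opposite to the fixed part \<open>x\<close> of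
      \<open>p 0\<close>. The polygon is compared with the two chords from \<open>x + y\<close>
      through this vertex to \<open>x + A *v y\<close>.\<close>
    obtain j where j: "j < m" "p (Suc j) \<bullet> x \<le> 0" using balanced[OF x] by blast
    have "t_min (Psi A) / 2 \<le> ?\<kappa>" using half_le_sin[of "t_min (Psi A) / 2"] gap(1,2) by simp
    from mult_right_mono[OF this \<omega>]
    have "\<omega> * t_min (Psi A) / 2 \<le> ?\<kappa> * norm (x + y)"
      using sphere[of 0] xy(3) by (simp add: mult_ac)
    also have "\<dots> \<le> norm (p (Suc j) - (x + y)) + norm (x + A *v y - p (Suc j))"
    proof (rule two_chords_lower_bound[OF xy0 xAy j(2)])
      show "0 \<le> ?\<kappa>" using gap(1,2) by (auto intro!: sin_ge_zero)
      show "?\<kappa> \<le> 2" by simp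
      show "?\<kappa> * norm y \<le> norm (A *v y - y)" by (rule displacement_ge_on_complement[OF A False y])
    qed
    also have "\<dots> = norm (p (Suc j) - p 0) + norm (p (Suc m) - p (Suc j))"
      using x by (simp add: closing xy(3) matrix_vector_right_distrib)
    also have "\<dots> \<le> (\<Sum>j<Suc m. norm (p (Suc j) - p j))"
      using chord_le_variation[of 0 "Suc j" p] chord_le_variation[of "Suc j" "Suc m" p] j(1) by simp
    finally show ?thesis by (simp add: lessThan_Suc_atMost)
  qed
qed

section \<open>From trajectories to the length estimate\<close>

text \<open>The vectors \<open>u\<close> and \<open>w\<close> extend the velocity polygon before the
  start and after the end. The alternatives (a)--(d) only decide at which of the two ends a
  reflection is inserted; at the other the jump is trivial.\<close>

lemma billiard_trajectory_end_velocities: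
  assumes \<Omega>: "smooth_convex_body \<Omega>" "ball c r \<subseteq> \<Omega>" "r > 0"
    and tr: "billiard_trajectory A \<Omega> T B \<sigma>"
    and s0: "s > 0" "\<sigma> 0 + s *\<^sub>R vel_plus \<sigma> 0 \<in> \<Omega>"
    and s1: "s' > 0" "\<sigma> T - s' *\<^sub>R vel_minus \<sigma> T \<in> \<Omega>"
  obtains u w where "inward_jump c r (\<sigma> 0) u (vel_plus \<sigma> 0)"
    "inward_jump c r (\<sigma> T) (vel_minus \<sigma> T) w" "A *v u = w"
proof -
  have T: "0 < T" and im: "\<sigma> ` {0..T} \<subseteq> \<Omega>" using tr by (simp_all add: billiard_trajectory_def)
  have loc: "\<sigma> t \<in> interior \<Omega> \<or> \<sigma> t \<in> frontier \<Omega>" if "t \<in> {0..T}" for t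
  proof -
    have "\<sigma> t \<in> \<Omega>" using im that by blast
    then show ?thesis using closure_subset by (auto simp: frontier_def)
  qed
  have start: "inward_jump c r (\<sigma> 0) (vel_before_start \<Omega> \<sigma>) (vel_plus \<sigma> 0)" if "\<sigma> 0 \<in> frontier \<Omega>"
    using bounces_imp_inward_jump[OF \<Omega> that vel_before_start_bounces[where \<sigma> = \<sigma>, OF \<Omega>(1) that] s0(1)] s0(2)
    by blast
  have "end": "inward_jump c r (\<sigma> T) (vel_minus \<sigma> T) (vel_after_end \<Omega> T \<sigma>)" if "\<sigma> T \<in> frontier \<Omega>"
    using bounces_imp_inward_jump[OF \<Omega> that vel_after_end_bounces[where \<sigma> = \<sigma>, OF \<Omega>(1) that] s1(1)] s1(2)
    by blast
  have triv: "inward_jump c r x v v" for x v by (simp add: inward_jump_def)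
  let ?a = "A *v vel_plus \<sigma> 0 = vel_minus \<sigma> T"
  let ?b = "A *v vel_before_start \<Omega> \<sigma> = vel_minus \<sigma> T"
  let ?c = "A *v vel_plus \<sigma> 0 = vel_after_end \<Omega> T \<sigma>"
  let ?d = "A *v vel_before_start \<Omega> \<sigma> = vel_after_end \<Omega> T \<sigma>"
  have "(\<sigma> 0 \<in> interior \<Omega> \<and> \<sigma> T \<in> interior \<Omega> \<longrightarrow> ?a) \<and>
    (\<sigma> 0 \<in> frontier \<Omega> \<and> \<sigma> T \<in> interior \<Omega> \<longrightarrow> ?a \<or> ?b) \<and>
    (\<sigma> 0 \<in> interior \<Omega> \<and> \<sigma> T \<in> frontier \<Omega> \<longrightarrow> ?a \<or> ?c) \<and>
    (\<sigma> 0 \<in> frontier \<Omega> \<and> \<sigma> T \<in> frontier \<Omega> \<longrightarrow> ?a \<or> ?b \<or> ?c \<or> ?d)"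
    using tr unfolding billiard_trajectory_def Let_def by (elim conjE) (intro conjI)
  moreover have "\<sigma> 0 \<in> interior \<Omega> \<or> \<sigma> 0 \<in> frontier \<Omega>" "\<sigma> T \<in> interior \<Omega> \<or> \<sigma> T \<in> frontier \<Omega>"
    using loc T by simp_all
  ultimately consider ?a | "\<sigma> 0 \<in> frontier \<Omega>" ?b | "\<sigma> T \<in> frontier \<Omega>" ?c
    | "\<sigma> 0 \<in> frontier \<Omega>" "\<sigma> T \<in> frontier \<Omega>" ?d
    by argo
  then show ?thesis
  proof cases
    case 1
    show ?thesis by (rule that[OF triv triv 1])
  next
    case 2
    show ?thesis by (rule that[OF start[OF 2(1)] triv 2(2)])
  next
    case 3
    show ?thesis by (rule that[OF triv "end"[OF 3(1)] 3(2)])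
  next
    case 4
    show ?thesis by (rule that[OF start[OF 4(1)] "end"[OF 4(2)] 4(3)])
  qed
qed

lemma sorted_partition:
  fixes B :: "real set"
  assumes B: "finite B" "B \<subseteq> {0<..<T}" "0 < T"
  defines "ts \<equiv> 0 # sorted_list_of_set B @ [T]"
  shows "length ts = card B + 2" "ts ! 0 = 0" "ts ! (card B + 1) = T"
    and "\<And>j. 0 < j \<Longrightarrow> j < card B + 1 \<Longrightarrow> ts ! j \<in> B"
    and "\<And>j. j < card B + 1 \<Longrightarrow> ts ! j < ts ! Suc j"
    and "\<And>j. j < card B + 1 \<Longrightarrow> {ts ! j<..<ts ! Suc j} \<inter> B = {}"
    and "\<And>j. j \<le> card B + 1 \<Longrightarrow> ts ! j \<in> {0..T}"
proof -
  let ?m = "card B + 1"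
  show len: "length ts = card B + 2" and "ts ! 0 = 0" by (simp_all add: ts_def)
  show last: "ts ! (card B + 1) = T" by (simp add: ts_def nth_append)
  have set: "set ts = insert 0 (insert T B)" using B by (simp add: ts_def insert_commute)
  have sd: "sorted_wrt (<) ts"
    using B by (auto simp: ts_def sorted_wrt_append strict_sorted_iff)
  show mid: "ts ! j \<in> B" if j: "0 < j" "j < ?m" for j
  proof -
    obtain i where "j = Suc i" using j(1) by (cases j) auto
    then have i: "i < length (sorted_list_of_set B)" "j = Suc i" using j B by simp_all
    then have "ts ! j = sorted_list_of_set B ! i" by (simp add: ts_def nth_append)
    then show ?thesis using nth_mem[OF i(1)] B by simp
  qed
  show less: "ts ! j < ts ! Suc j" if "j < ?m" for j
    using sorted_wrt_nth_less[OF sd, of j "Suc j"] that len by simp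
  show "{ts ! j<..<ts ! Suc j} \<inter> B = {}" if j: "j < ?m" for j
  proof (rule ccontr)
    assume "\<not> ?thesis"
    then obtain b where b: "ts ! j < b" "b < ts ! Suc j" "b \<in> B" by auto
    then have "b \<in> set ts" using set by simp
    then obtain i where i: "i < length ts" "b = ts ! i" by (metis in_set_conv_nth)
    have "j < i"
    proof (rule ccontr)
      assume "\<not> j < i"
      then have "ts ! i \<le> ts ! j"
        using sorted_wrt_nth_less[OF sd, of i j] len j by (cases "i = j") auto
      then show False using b i by simp
    qed
    then have "ts ! Suc j \<le> ts ! i"
      using sorted_wrt_nth_less[OF sd, of "Suc j" i] i by (cases "Suc j = i") auto
    then show False using b i by simp
  qed
  show "ts ! j \<in> {0..T}" if "j \<le> ?m" for j
  proof -
    have "ts ! j \<in> set ts" using that len by simp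
    then show ?thesis using set B by auto
  qed
qed

lemma billiard_length_ge:
  fixes A :: "real^'n^'n"
  assumes A: "orthogonal_matrix A" and c: "A *v c = c"
    and \<Omega>: "smooth_convex_body \<Omega>" "ball c r \<subseteq> \<Omega>" "r > 0"
    and tr: "billiard_trajectory A \<Omega> T B \<sigma>"
  shows "r * t_min (Psi A) / 2 \<le> billiard_length T B \<sigma>"
proof -
  have T: "0 < T" and im: "\<sigma> ` {0..T} \<subseteq> \<Omega>" and cont: "continuous_on {0..T} \<sigma>"
    and end_eq: "\<sigma> T = A *v \<sigma> 0" and B: "finite B" "B \<subseteq> {0<..<T}" "card B \<ge> 1"
    and diff: "\<And>t. t \<in> {0<..<T} - B \<Longrightarrow> \<sigma> differentiable (at t) \<and> (velocity \<sigma> has_vector_derivative 0) (at t)"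
    and front: "\<And>t. t \<in> B \<Longrightarrow> \<sigma> t \<in> frontier \<Omega>"
    and reflection: "\<And>t. t \<in> B \<Longrightarrow> bounces \<Omega> (\<sigma> t) (vel_minus \<sigma> t) (vel_plus \<sigma> t)"
    and kink: "\<And>t. t \<in> B \<Longrightarrow> vel_plus \<sigma> t \<noteq> vel_minus \<sigma> t"
    using tr by (auto simp: billiard_trajectory_def bounces_def)
  define ts where "ts = 0 # sorted_list_of_set B @ [T]"
  define m where "m = card B + 1"
  note part = sorted_partition[OF B(1,2) T, folded ts_def m_def]
  define v where "v = (\<lambda>j. vel_plus \<sigma> (ts ! j))"
  define \<tau> where "\<tau> = (\<lambda>j. ts ! Suc j - ts ! j)"
  have m: "m > 0" by (simp add: m_def)
  have \<tau>: "\<tau> j > 0" if "j < m" for j using part(5)[OF that] by (simp add: \<tau>_def)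
  have piece: "\<sigma> (ts ! Suc j) - \<sigma> (ts ! j) = \<tau> j *\<^sub>R v j" "vel_minus \<sigma> (ts ! Suc j) = v j" if j: "j < m" for j
  proof -
    have sub: "{ts ! j..ts ! Suc j} \<subseteq> {0..T}" using part(7)[of j] part(7)[of "Suc j"] j by auto
    have sub': "t \<in> {0<..<T} - B" if "t \<in> {ts ! j<..<ts ! Suc j}" for t
      using part(7)[of j] part(7)[of "Suc j"] part(6)[OF j] j that by auto
    show "\<sigma> (ts ! Suc j) - \<sigma> (ts ! j) = \<tau> j *\<^sub>R v j" "vel_minus \<sigma> (ts ! Suc j) = v j"
      using affine_piece[OF part(5)[OF j] continuous_on_subset[OF cont sub]] diff sub'
      unfolding \<tau>_def v_def by blast+
  qed
  have inside: "\<sigma> (ts ! j) \<in> \<Omega>" if "j \<le> m" for j using im part(7)[OF that] by blast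
  have fwd: "\<sigma> (ts ! j) + \<tau> j *\<^sub>R v j \<in> \<Omega>" if "j < m" for j
    using inside[of "Suc j"] piece(1)[OF that] that by (simp add: algebra_simps)
  have bwd: "\<sigma> (ts ! Suc j) - \<tau> j *\<^sub>R v j \<in> \<Omega>" if "j < m" for j
    using inside[of j] piece(1)[OF that] that by (simp add: algebra_simps)
  obtain k where k: "m = Suc k" using m gr0_implies_Suc by blast
  have endpoints: "ts ! 0 = 0" "ts ! m = T" by (rule part(2), rule part(3))
  \<comment> \<open>Times \<tau> 0 and \<tau> k are the durations of the first and last edges, whose
    far ends lie in \<Omega>.\<close>
  obtain u w where u: "inward_jump c r (\<sigma> 0) u (vel_plus \<sigma> 0)"
    and w: "inward_jump c r (\<sigma> T) (vel_minus \<sigma> T) w" and uw: "A *v u = w"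
  proof (rule billiard_trajectory_end_velocities[OF \<Omega> tr, of "\<tau> 0" "\<tau> k"])
    show "\<sigma> 0 + \<tau> 0 *\<^sub>R vel_plus \<sigma> 0 \<in> \<Omega>" using fwd[OF m] by (simp add: v_def endpoints)
    show "\<sigma> T - \<tau> k *\<^sub>R vel_minus \<sigma> T \<in> \<Omega>"
      using bwd[of k] piece(2)[of k] endpoints k by simp
  qed (use \<tau> k that in auto)
  \<comment> \<open>\<open>p j\<close> and \<open>p (Suc j)\<close> are the velocities before and after time \<open>ts ! j\<close>.\<close>
  define p where "p = (\<lambda>j. if j = 0 then u else if j \<le> m then v (j - 1) else w)"
  have p: "p 0 = u" "p (Suc m) = w" "p (Suc j) = v j" if "j < m" for j
    using that by (simp_all add: p_def)
  define Q where "Q = (\<lambda>j. \<sigma> (ts ! j) - c)"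
  have jump: "inward_jump c r (\<sigma> (ts ! j)) (p j) (p (Suc j))" if "j \<le> m" for j
  proof -
    consider "j = 0" | i where "j = Suc i" "j < m" | "j = m" using \<open>j \<le> m\<close> by (cases j) fastforce+
    then show ?thesis
    proof cases
      case 1
      then show ?thesis using u p m by (simp add: endpoints v_def)
    next
      case (2 i)
      then have b: "ts ! j \<in> B" using part(4)[of j] by simp
      have pj: "p j = v i" "vel_minus \<sigma> (ts ! j) = v i" "p (Suc j) = v j" "vel_plus \<sigma> (ts ! j) = v j"
        using 2 p piece(2)[of i] by (simp_all add: v_def)
      show ?thesis
        using bounces_imp_inward_jump[OF \<Omega> front[OF b] reflection[OF b] \<tau>[of i]] bwd[of i] 2 pj by simp
    next
      case 3
      then show ?thesis using w p[of k] piece(2)[of k] k endpoints(2) by simp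
    qed
  qed
  define \<omega> where "\<omega> = norm u"
  have sphere: "norm (p j) = \<omega>" if "j \<le> Suc m" for j
    using that
  proof (induction j)
    case (Suc j)
    then show ?case using jump[of j] by (simp add: inward_jump_def)
  qed (simp add: p_def \<omega>_def)
  \<comment> \<open>At zero speed there would be no velocity jump at the first bounce, against
    \<open>kink\<close>; that bounce exists because \<open>B\<close> is nonempty.\<close>
  have "\<omega> \<noteq> 0"
  proof
    assume "\<omega> = 0"
    then have "p j = 0" if "j \<le> Suc m" for j using sphere[OF that] by simp
    moreover have "1 < m" using B(3) by (simp add: m_def)
    ultimately have "v 0 = 0" "v 1 = 0" using p(3)[of 0] p(3)[of 1] by simp_all
    then show False using kink[of "ts ! 1"] part(4)[of 1] piece(2)[of 0] \<open>1 < m\<close>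
      by (simp add: v_def)
  qed
  then have \<omega>: "\<omega> > 0" by (simp add: \<omega>_def)
  have step: "Q (Suc j) - Q j = \<tau> j *\<^sub>R p (Suc j)" if "j < m" for j
    using piece(1)[OF that] p(3)[OF that] by (simp add: Q_def)
  note iso = orthogonal_matrix_inner[OF A]
  have Qm: "Q m = A *v Q 0"
    by (simp add: Q_def endpoints end_eq c matrix_vector_mult_diff_distrib)
  have len: "billiard_length T B \<sigma> = (\<Sum>j<m. \<tau> j) * \<omega>"
  proof -
    have "billiard_length T B \<sigma> = (\<Sum>j<m. norm (\<sigma> (ts ! Suc j) - \<sigma> (ts ! j)))"
      unfolding billiard_length_def Let_def ts_def[symmetric] using part(1) by (simp add: m_def)
    also have "\<dots> = (\<Sum>j<m. \<tau> j * \<omega>)"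
    proof (intro sum.cong refl)
      fix j assume "j \<in> {..<m}"
      then have j: "j < m" by simp
      show "norm (\<sigma> (ts ! Suc j) - \<sigma> (ts ! j)) = \<tau> j * \<omega>"
        unfolding piece(1)[OF j] using \<tau>[OF j] sphere[of "Suc j"] p(3)[OF j] j by simp
    qed
    finally show ?thesis by (simp add: sum_distrib_right)
  qed
  have "r * (\<omega> * t_min (Psi A) / 2) \<le> r * (\<Sum>j\<le>m. norm (p (Suc j) - p j))"
  proof (intro mult_left_mono velocity_variation_ge[OF A])
    have "(\<Sum>j<m. \<tau> j *\<^sub>R p (Suc j)) = (\<Sum>j<m. Q (Suc j) - Q j)" using step by simp
    also have "\<dots> = A *v Q 0 - Q 0" by (simp add: sum_lessThan_telescope Qm)
    \<comment> \<open>A displacement \<open>A q - q\<close> under an isometry is orthogonal to every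
      fixed vector.\<close>
    also have "\<dots> \<in> orthogonal_comp {x. A *v x = x}"
    proof -
      have "x \<bullet> (A *v Q 0 - Q 0) = 0" if "A *v x = x" for x
        using iso[of x "Q 0"] that by (simp add: inner_diff_right)
      then show ?thesis by (simp add: orthogonal_comp_def orthogonal_def)
    qed
    finally show "(\<Sum>j<m. \<tau> j *\<^sub>R p (Suc j)) \<in> orthogonal_comp {x. A *v x = x}" .
  qed (use sphere \<tau> m \<Omega>(3) uw in \<open>auto simp: p_def\<close>)
  also have "\<dots> \<le> (\<Sum>j<m. \<tau> j * (norm (p (Suc j)))\<^sup>2)"
  proof (rule variation_le_energy[where Q = Q and p = p and \<tau> = \<tau>, OF step])
    show "r * norm (p (Suc j) - p j) \<le> Q j \<bullet> (p j - p (Suc j))" if "j \<le> m" for j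
      using jump[OF that] by (simp add: inward_jump_def Q_def)
    \<comment> \<open>Position relative to the fixed point \<open>c\<close> and velocity are both
      carried by \<open>A\<close> from start to end, so their inner product is preserved.\<close>
    show "Q m \<bullet> p (Suc m) = Q 0 \<bullet> p 0"
      unfolding Qm using iso[of "Q 0" u] uw by (simp add: p_def)
  qed
  also have "\<dots> = \<omega> * ((\<Sum>j<m. \<tau> j) * \<omega>)"
    using sphere by (simp add: sum_distrib_left sum_distrib_right power2_eq_square mult_ac)
  finally have "\<omega> * (r * t_min (Psi A) / 2) \<le> \<omega> * billiard_length T B \<sigma>"
    by (simp add: len mult_ac)
  then show ?thesis using \<omega> by (simp only: mult_le_cancel_left_pos)
qed

theorem theorem1p11:
  fixes A :: "real^'n^'n" and \<Delta> :: "(real^'n) set" and qbar :: "real^'n" and r :: real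
  assumes "orthogonal_matrix A"
    and "smooth_convex_body \<Delta>"
    and "{x. A *v x = x} \<inter> interior \<Delta> \<noteq> {}"
    and "r > 0"
    and "A *v qbar = qbar"
    and "ball qbar r \<subseteq> \<Delta>"
  shows "ereal (r * t_min (Psi A) / 2)
    \<le> Inf {ereal (billiard_length T B \<sigma>) | T B \<sigma>. billiard_trajectory A \<Delta> T B \<sigma>}"
proof (rule Inf_greatest)
  fix l assume "l \<in> {ereal (billiard_length T B \<sigma>) | T B \<sigma>. billiard_trajectory A \<Delta> T B \<sigma>}"
  then obtain T B \<sigma> where "l = ereal (billiard_length T B \<sigma>)" "billiard_trajectory A \<Delta> T B \<sigma>"
    by blast
  then show "ereal (r * t_min (Psi A) / 2) \<le> l"
    using billiard_length_ge[OF assms(1,5,2,6,4)] by simp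
qed

end
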